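(* The assignment $\mathfrak{A}\mapsto\mathrm{ufam}(\mathfrak{A})$ gives rise to a 2-functor $$\mathrm{ufam}(-):\mathbf{UOrd}\to\mathbf{PFib}(\mathbf{Set})$$ into posetal fibrations on $\mathbf{Set}$ which is a local equivalence. This 2-functor fits into a commutative (up to isomorphism) triangle of local equivalences: the composite of the 2-functor $\mathbf{Ord}\to\mathbf{UOrd}$, $(D,\le)\mapsto(D,\mathord{\downarrow}\{\le\})$, with $\mathrm{ufam}(-)$ is isomorphic to the family construction $\mathrm{fam}(-):\mathbf{Ord}\to\mathbf{PFib}(\mathbf{Set})$.
   Context: **$\mathbf{UOrd}$.** A uniform preorder is a triple $(I,A,R)$ with $I$ a set, $A=(A_i)_{i\in I}$ a family of sets and $R=(R_{ij})_{i,j\in I}$, $R_{ij}\subseteq P(A_i\times A_j)$, such that (a) $r\in R_{ij}$, $s\subseteq r$ imply $s\in R_{ij}$; (b) $\mathrm{id}\in R_{ii}$; (c) $r\in R_{ij}$, $s\in R_{jk}$ imply $sr\in R_{ik}$, where $sr=\{(x,z)\mid\exists y:(x,y)\in r,(y,z)\in s\}$. A monotone map $(I,A,R)\to(J,B,S)$ is a pair $(u:I\to J,(f_i:A_i\to B_{ui})_{i\in I})$ such that $r\in R_{ij}$ implies $\{(f_ia,f_jb)\mid(a,b)\in r\}\in S_{ui,uj}$. For parallel maps, $(u,f)\le(v,g)$ iff $\{(f_ia,g_ia)\mid a\in A_i\}\in S_{ui,vi}$ for all $i\in I$. Uniform preorders and monotone maps form the order-enriched category $\mathbf{UOrd}$.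 **$\mathbf{PFib}(\mathbf{Set})$** is the locally (pre)ordered category of posetal fibrations on $\mathbf{Set}$ (fibrations faithful as functors, equivalently with preorders as fibers) and fibered functors (monotone maps commuting with reindexing up to isomorphism), ordered fiberwise/pointwise. **$\mathrm{ufam}$.** $\mathrm{ufam}(I,A,R)$ is the posetal fibration on $\mathbf{Set}$ whose predicates on $M$ are pairs $(i\in I,\varphi:M\to A_i)$, with $(i,\varphi)\le(j,\psi)$ iff $\{(\varphi m,\psi m)\mid m\in M\}\in R_{ij}$, reindexing by precomposition; a monotone map $(u,f)$ acts by $(i,\varphi)\mapsto(ui,f_i\circ\varphi)$. **$\mathbf{Ord}$, $\mathrm{fam}$.** $\mathbf{Ord}$ is the locally ordered category of preorders and monotone maps. For a preorder $(D,\le)$, $(D,\mathord{\downarrow}\{\le\})$ is the one-sorted uniform preorder on $D$ whose relations are all subrelations of $\le$. $\mathrm{fam}(D)$ is the posetal fibration whose predicates on $M$ are functions $\varphi:M\to D$ ordered pointwise, reindexing by precomposition. A 2-functor between locally preordered categories is a local equivalence if its action on each hom-preorder is an equivalence of preorders (order-reflecting and essentially surjective). *)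

theory Defs
  imports Main "HOL-Library.FuncSet"
begin

section \<open>Categories and functors\<close>

text \<open>
  Hom-sets need not be disjoint, so composition, identities and the action of a functor on
  arrows carry their objects: \<open>Comp C X Y Z g f\<close> is the composite of \<open>f : X \<rightarrow> Y\<close> and \<open>g : Y \<rightarrow> Z\<close>.
\<close>

record ('o, 'a) cat =
  Obj :: "'o set"
  Hom :: "'o \<Rightarrow> 'o \<Rightarrow> 'a set"
  Id :: "'o \<Rightarrow> 'a"
  Comp :: "'o \<Rightarrow> 'o \<Rightarrow> 'o \<Rightarrow> 'a \<Rightarrow> 'a \<Rightarrow> 'a"

definition category :: "('o, 'a, 'm) cat_scheme \<Rightarrow> bool" where
  "category C \<longleftrightarrow>
     (\<forall>X\<in>Obj C. Id C X \<in> Hom C X X) \<and>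
     (\<forall>X\<in>Obj C. \<forall>Y\<in>Obj C. \<forall>Z\<in>Obj C. \<forall>f\<in>Hom C X Y. \<forall>g\<in>Hom C Y Z.
        Comp C X Y Z g f \<in> Hom C X Z) \<and>
     (\<forall>X\<in>Obj C. \<forall>Y\<in>Obj C. \<forall>f\<in>Hom C X Y.
        Comp C X X Y f (Id C X) = f \<and> Comp C X Y Y (Id C Y) f = f) \<and>
     (\<forall>W\<in>Obj C. \<forall>X\<in>Obj C. \<forall>Y\<in>Obj C. \<forall>Z\<in>Obj C.
        \<forall>f\<in>Hom C W X. \<forall>g\<in>Hom C X Y. \<forall>h\<in>Hom C Y Z.
        Comp C W X Z (Comp C X Y Z h g) f = Comp C W Y Z h (Comp C W X Y g f))"

record ('o, 'a, 'p, 'b) ftor =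
  fob :: "'o \<Rightarrow> 'p"
  farr :: "'o \<Rightarrow> 'o \<Rightarrow> 'a \<Rightarrow> 'b"

definition is_functor ::
  "('o, 'a, 'm) cat_scheme \<Rightarrow> ('p, 'b, 'n) cat_scheme \<Rightarrow> ('o, 'a, 'p, 'b) ftor \<Rightarrow> bool" where
  "is_functor C D F \<longleftrightarrow> category C \<and> category D \<and>
     (\<forall>X\<in>Obj C. fob F X \<in> Obj D) \<and>
     (\<forall>X\<in>Obj C. \<forall>Y\<in>Obj C. \<forall>f\<in>Hom C X Y. farr F X Y f \<in> Hom D (fob F X) (fob F Y)) \<and>
     (\<forall>X\<in>Obj C. farr F X X (Id C X) = Id D (fob F X)) \<and>
     (\<forall>X\<in>Obj C. \<forall>Y\<in>Obj C. \<forall>Z\<in>Obj C. \<forall>f\<in>Hom C X Y. \<forall>g\<in>Hom C Y Z.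
        farr F X Z (Comp C X Y Z g f) =
        Comp D (fob F X) (fob F Y) (fob F Z) (farr F Y Z g) (farr F X Y f))"

definition faithful ::
  "('o, 'a, 'm) cat_scheme \<Rightarrow> ('o, 'a, 'p, 'b) ftor \<Rightarrow> bool" where
  "faithful C F \<longleftrightarrow> (\<forall>X\<in>Obj C. \<forall>Y\<in>Obj C. inj_on (farr F X Y) (Hom C X Y))"

text \<open>
  Functors that occur as 1-cells are \<open>undefined\<close> off their domain, so that equality of
  records is equality of functors.
\<close>

definition ext_ftor :: "('o, 'a, 'm) cat_scheme \<Rightarrow> ('o, 'a, 'p, 'b) ftor \<Rightarrow> bool" where
  "ext_ftor C F \<longleftrightarrow>
     fob F \<in> extensional (Obj C) \<and> farr F \<in> extensional (Obj C) \<and>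
     (\<forall>X\<in>Obj C. farr F X \<in> extensional (Obj C) \<and>
        (\<forall>Y\<in>Obj C. farr F X Y \<in> extensional (Hom C X Y)))"

definition mk_ftor ::
  "('o, 'a, 'm) cat_scheme \<Rightarrow> ('o \<Rightarrow> 'p) \<Rightarrow> ('o \<Rightarrow> 'o \<Rightarrow> 'a \<Rightarrow> 'b) \<Rightarrow> ('o, 'a, 'p, 'b) ftor" where
  "mk_ftor C F0 F1 =
     \<lparr>fob = restrict F0 (Obj C),
      farr = (\<lambda>X\<in>Obj C. \<lambda>Y\<in>Obj C. \<lambda>f\<in>Hom C X Y. F1 X Y f)\<rparr>"

definition id_ftor :: "('o, 'a, 'm) cat_scheme \<Rightarrow> ('o, 'a, 'o, 'a) ftor" where
  "id_ftor C = mk_ftor C (\<lambda>X. X) (\<lambda>X Y f. f)"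

definition comp_ftor ::
  "('o, 'a, 'm) cat_scheme \<Rightarrow> ('p, 'b, 'q, 'c) ftor \<Rightarrow> ('o, 'a, 'p, 'b) ftor
    \<Rightarrow> ('o, 'a, 'q, 'c) ftor" where
  "comp_ftor C G F =
     mk_ftor C (\<lambda>X. fob G (fob F X)) (\<lambda>X Y f. farr G (fob F X) (fob F Y) (farr F X Y f))"


section \<open>Locally preordered categories and 2-functors\<close>

record ('o, 'a) lpcat = "('o, 'a) cat" +
  Le :: "'o \<Rightarrow> 'o \<Rightarrow> 'a \<Rightarrow> 'a \<Rightarrow> bool"

definition lpcategory :: "('o, 'a, 'm) lpcat_scheme \<Rightarrow> bool" where
  "lpcategory C \<longleftrightarrow> category C \<and>
     (\<forall>X\<in>Obj C. \<forall>Y\<in>Obj C. \<forall>f\<in>Hom C X Y. Le C X Y f f) \<and>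
     (\<forall>X\<in>Obj C. \<forall>Y\<in>Obj C. \<forall>f\<in>Hom C X Y. \<forall>g\<in>Hom C X Y. \<forall>h\<in>Hom C X Y.
        Le C X Y f g \<longrightarrow> Le C X Y g h \<longrightarrow> Le C X Y f h) \<and>
     (\<forall>X\<in>Obj C. \<forall>Y\<in>Obj C. \<forall>Z\<in>Obj C.
        \<forall>f\<in>Hom C X Y. \<forall>f'\<in>Hom C X Y. \<forall>g\<in>Hom C Y Z. \<forall>g'\<in>Hom C Y Z.
        Le C X Y f f' \<longrightarrow> Le C Y Z g g' \<longrightarrow>
        Le C X Z (Comp C X Y Z g f) (Comp C X Y Z g' f'))"

definition two_functor ::
  "('o, 'a, 'm) lpcat_scheme \<Rightarrow> ('p, 'b, 'n) lpcat_scheme \<Rightarrow> ('o, 'a, 'p, 'b) ftor \<Rightarrow> bool" where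
  "two_functor C D F \<longleftrightarrow> lpcategory C \<and> lpcategory D \<and> is_functor C D F \<and>
     (\<forall>X\<in>Obj C. \<forall>Y\<in>Obj C. \<forall>f\<in>Hom C X Y. \<forall>g\<in>Hom C X Y.
        Le C X Y f g \<longrightarrow> Le D (fob F X) (fob F Y) (farr F X Y f) (farr F X Y g))"

definition local_equivalence ::
  "('o, 'a, 'm) lpcat_scheme \<Rightarrow> ('p, 'b, 'n) lpcat_scheme \<Rightarrow> ('o, 'a, 'p, 'b) ftor \<Rightarrow> bool" where
  "local_equivalence C D F \<longleftrightarrow> two_functor C D F \<and>
     (\<forall>X\<in>Obj C. \<forall>Y\<in>Obj C.
        (\<forall>f\<in>Hom C X Y. \<forall>g\<in>Hom C X Y.
           Le D (fob F X) (fob F Y) (farr F X Y f) (farr F X Y g) \<longrightarrow> Le C X Y f g) \<and>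
        (\<forall>h\<in>Hom D (fob F X) (fob F Y). \<exists>f\<in>Hom C X Y.
           Le D (fob F X) (fob F Y) (farr F X Y f) h \<and>
           Le D (fob F X) (fob F Y) h (farr F X Y f)))"

definition iso_arrow :: "('o, 'a, 'm) cat_scheme \<Rightarrow> 'o \<Rightarrow> 'o \<Rightarrow> 'a \<Rightarrow> bool" where
  "iso_arrow C X Y f \<longleftrightarrow> f \<in> Hom C X Y \<and>
     (\<exists>g\<in>Hom C Y X. Comp C X Y X g f = Id C X \<and> Comp C Y X Y f g = Id C Y)"

text \<open>
  A strict 2-natural isomorphism. Between locally preordered categories there is no condition
  on 2-cells beyond naturality on 1-cells.
\<close>

definition two_functors_isomorphic ::
  "('o, 'a, 'm) lpcat_scheme \<Rightarrow> ('p, 'b, 'n) lpcat_scheme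
    \<Rightarrow> ('o, 'a, 'p, 'b) ftor \<Rightarrow> ('o, 'a, 'p, 'b) ftor \<Rightarrow> bool" where
  "two_functors_isomorphic C D F G \<longleftrightarrow> two_functor C D F \<and> two_functor C D G \<and>
     (\<exists>\<eta>. (\<forall>X\<in>Obj C. iso_arrow D (fob F X) (fob G X) (\<eta> X)) \<and>
       (\<forall>X\<in>Obj C. \<forall>Y\<in>Obj C. \<forall>f\<in>Hom C X Y.
          Comp D (fob F X) (fob F Y) (fob G Y) (\<eta> Y) (farr F X Y f) =
          Comp D (fob F X) (fob G X) (fob G Y) (farr G X Y f) (\<eta> X)))"


section \<open>The category of sets\<close>

text \<open>
  \<open>U\<close> is the collection of small sets. Only closure under subsets, images and (coded) binary
  products is required, so a Grothendieck universe is one instance among others; so is the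
  collection of all subsets of an infinite type, by the lemma below.
\<close>

definition set_universe :: "'u set set \<Rightarrow> bool" where
  "set_universe U \<longleftrightarrow>
     (\<exists>M\<in>U. M \<noteq> {}) \<and>
     (\<forall>M\<in>U. \<forall>N. N \<subseteq> M \<longrightarrow> N \<in> U) \<and>
     (\<forall>M\<in>U. \<forall>f :: 'u \<Rightarrow> 'u. f ` M \<in> U) \<and>
     (\<forall>M\<in>U. \<forall>N\<in>U. \<exists>e :: 'u \<times> 'u \<Rightarrow> 'u. inj_on e (M \<times> N) \<and> e ` (M \<times> N) \<in> U)"

lemma set_universe_UNIV:
  assumes "infinite (UNIV :: 'u set)"
  shows "set_universe (UNIV :: 'u set set)"
proof -
  obtain e :: "'u \<times> 'u \<Rightarrow> 'u" where "bij_betw e (UNIV \<times> UNIV) UNIV"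
    using card_of_ordIso[THEN iffD2, OF card_of_Times_same_infinite[OF assms]] by blast
  then have "inj_on e (M \<times> N)" for M N
    by (metis UNIV_Times_UNIV bij_betw_def inj_on_subset subset_UNIV)
  then show ?thesis
    unfolding set_universe_def by blast
qed

definition set_cat :: "'u set set \<Rightarrow> ('u set, 'u \<Rightarrow> 'u) cat" where
  "set_cat U =
     \<lparr>Obj = U, Hom = (\<lambda>M N. M \<rightarrow>\<^sub>E N), Id = (\<lambda>M. \<lambda>x\<in>M. x), Comp = (\<lambda>L M N g f. compose L g f)\<rparr>"


section \<open>Posetal fibrations\<close>

record ('e, 'c, 'o, 'a) over =
  total :: "('e, 'c) cat"
  proj :: "('e, 'c, 'o, 'a) ftor"

definition cartesian ::
  "('o, 'a, 'm) cat_scheme \<Rightarrow> ('e, 'c, 'o, 'a) over \<Rightarrow> 'e \<Rightarrow> 'e \<Rightarrow> 'c \<Rightarrow> bool" where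
  "cartesian B P X Y f \<longleftrightarrow> f \<in> Hom (total P) X Y \<and>
     (\<forall>Z\<in>Obj (total P). \<forall>h\<in>Hom (total P) Z Y.
        \<forall>v\<in>Hom B (fob (proj P) Z) (fob (proj P) X).
        Comp B (fob (proj P) Z) (fob (proj P) X) (fob (proj P) Y) (farr (proj P) X Y f) v
          = farr (proj P) Z Y h \<longrightarrow>
        (\<exists>!k. k \<in> Hom (total P) Z X \<and> farr (proj P) Z X k = v \<and>
           Comp (total P) Z X Y f k = h))"

definition fibration :: "('o, 'a, 'm) cat_scheme \<Rightarrow> ('e, 'c, 'o, 'a) over \<Rightarrow> bool" where
  "fibration B P \<longleftrightarrow> is_functor (total P) B (proj P) \<and>
     (\<forall>Y\<in>Obj (total P). \<forall>M\<in>Obj B. \<forall>g\<in>Hom B M (fob (proj P) Y).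
        \<exists>X\<in>Obj (total P). \<exists>f. cartesian B P X Y f \<and> fob (proj P) X = M \<and>
          farr (proj P) X Y f = g)"

definition posetal_fibration ::
  "('o, 'a, 'm) cat_scheme \<Rightarrow> ('e, 'c, 'o, 'a) over \<Rightarrow> bool" where
  "posetal_fibration B P \<longleftrightarrow> fibration B P \<and> faithful (total P) (proj P)"

definition fibered_functor ::
  "('o, 'a, 'm) cat_scheme \<Rightarrow> ('e, 'c, 'o, 'a) over \<Rightarrow> ('f, 'd, 'o, 'a) over
    \<Rightarrow> ('e, 'c, 'f, 'd) ftor \<Rightarrow> bool" where
  "fibered_functor B P Q F \<longleftrightarrow> is_functor (total P) (total Q) F \<and>
     (\<forall>X\<in>Obj (total P). fob (proj Q) (fob F X) = fob (proj P) X) \<and>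
     (\<forall>X\<in>Obj (total P). \<forall>Y\<in>Obj (total P). \<forall>f\<in>Hom (total P) X Y.
        farr (proj Q) (fob F X) (fob F Y) (farr F X Y f) = farr (proj P) X Y f) \<and>
     (\<forall>X\<in>Obj (total P). \<forall>Y\<in>Obj (total P). \<forall>f.
        cartesian B P X Y f \<longrightarrow> cartesian B Q (fob F X) (fob F Y) (farr F X Y f))"

definition fiber_le ::
  "('o, 'a, 'm) cat_scheme \<Rightarrow> ('e, 'c, 'o, 'a) over \<Rightarrow> 'e \<Rightarrow> 'e \<Rightarrow> bool" where
  "fiber_le B P X Y \<longleftrightarrow> fob (proj P) X = fob (proj P) Y \<and>
     (\<exists>f\<in>Hom (total P) X Y. farr (proj P) X Y f = Id B (fob (proj P) X))"

definition PFib ::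
  "('o, 'a, 'm) cat_scheme \<Rightarrow> (('e, 'c, 'o, 'a) over, ('e, 'c, 'e, 'c) ftor) lpcat" where
  "PFib B =
     \<lparr>Obj = {P. posetal_fibration B P},
      Hom = (\<lambda>P Q. {F. fibered_functor B P Q F \<and> ext_ftor (total P) F}),
      Id = (\<lambda>P. id_ftor (total P)),
      Comp = (\<lambda>P Q R G F. comp_ftor (total P) G F),
      Le = (\<lambda>P Q F G. \<forall>X\<in>Obj (total P). fiber_le B Q (fob F X) (fob G X))\<rparr>"


section \<open>Uniform preorders\<close>

record 'u uord =
  sorts :: "'u set"
  car :: "'u \<Rightarrow> 'u set"
  rels :: "'u \<Rightarrow> 'u \<Rightarrow> ('u \<times> 'u) set set"

definition uniform_preorder :: "'u set set \<Rightarrow> 'u uord \<Rightarrow> bool" where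
  "uniform_preorder U X \<longleftrightarrow>
     sorts X \<in> U \<and> (\<forall>i\<in>sorts X. car X i \<in> U) \<and>
     (\<forall>i\<in>sorts X. \<forall>j\<in>sorts X. rels X i j \<subseteq> Pow (car X i \<times> car X j)) \<and>
     (\<forall>i\<in>sorts X. \<forall>j\<in>sorts X. \<forall>r\<in>rels X i j. \<forall>s. s \<subseteq> r \<longrightarrow> s \<in> rels X i j) \<and>
     (\<forall>i\<in>sorts X. Id_on (car X i) \<in> rels X i i) \<and>
     (\<forall>i\<in>sorts X. \<forall>j\<in>sorts X. \<forall>k\<in>sorts X. \<forall>r\<in>rels X i j. \<forall>s\<in>rels X j k.
        r O s \<in> rels X i k)"

definition uord_maps :: "'u uord \<Rightarrow> 'u uord \<Rightarrow> (('u \<Rightarrow> 'u) \<times> ('u \<Rightarrow> 'u \<Rightarrow> 'u)) set" where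
  "uord_maps X Y = {(u, f).
     u \<in> sorts X \<rightarrow>\<^sub>E sorts Y \<and>
     f \<in> (\<Pi>\<^sub>E i\<in>sorts X. car X i \<rightarrow>\<^sub>E car Y (u i)) \<and>
     (\<forall>i\<in>sorts X. \<forall>j\<in>sorts X. \<forall>r\<in>rels X i j.
        {(f i a, f j b) | a b. (a, b) \<in> r} \<in> rels Y (u i) (u j))}"

definition UOrd :: "'u set set \<Rightarrow> ('u uord, ('u \<Rightarrow> 'u) \<times> ('u \<Rightarrow> 'u \<Rightarrow> 'u)) lpcat" where
  "UOrd U =
     \<lparr>Obj = {X. uniform_preorder U X},
      Hom = uord_maps,
      Id = (\<lambda>X. (\<lambda>i\<in>sorts X. i, \<lambda>i\<in>sorts X. \<lambda>a\<in>car X i. a)),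
      Comp = (\<lambda>X Y Z (v, g) (u, f).
        (compose (sorts X) v u, \<lambda>i\<in>sorts X. compose (car X i) (g (u i)) (f i))),
      Le = (\<lambda>X Y (u, f) (v, g).
        \<forall>i\<in>sorts X. {(f i a, g i a) | a. a \<in> car X i} \<in> rels Y (u i) (v i))\<rparr>"


section \<open>Preorders\<close>

definition Ord :: "'u set set \<Rightarrow> ('u set \<times> ('u \<times> 'u) set, 'u \<Rightarrow> 'u) lpcat" where
  "Ord U =
     \<lparr>Obj = {(D, r). D \<in> U \<and> preorder_on D r},
      Hom = (\<lambda>(D, r) (E, s). {f \<in> D \<rightarrow>\<^sub>E E. \<forall>(x, y)\<in>r. (f x, f y) \<in> s}),
      Id = (\<lambda>(D, r). \<lambda>x\<in>D. x),
      Comp = (\<lambda>(D, r) (E, s) (H, t) g f. compose D g f),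
      Le = (\<lambda>(D, r) (E, s) f g. \<forall>x\<in>D. (f x, g x) \<in> s)\<rparr>"

text \<open>The single sort is the arbitrary element \<open>undefined\<close>.\<close>

definition one_sorted :: "'u set \<times> ('u \<times> 'u) set \<Rightarrow> 'u uord" where
  "one_sorted = (\<lambda>(D, r). \<lparr>sorts = {undefined}, car = (\<lambda>_. D), rels = (\<lambda>_ _. Pow r)\<rparr>)"

definition ord_to_uord ::
  "('u set \<times> ('u \<times> 'u) set, 'u \<Rightarrow> 'u, 'u uord, ('u \<Rightarrow> 'u) \<times> ('u \<Rightarrow> 'u \<Rightarrow> 'u)) ftor" where
  "ord_to_uord =
     \<lparr>fob = one_sorted, farr = (\<lambda>D E f. (\<lambda>i\<in>{undefined}. i, \<lambda>i\<in>{undefined}. f))\<rparr>"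


section \<open>The family constructions\<close>

text \<open>
  The fibration with predicates \<open>Pr M\<close> on \<open>M\<close>, ordered by \<open>le M\<close>, where \<open>re M g\<close> reindexes along
  a function \<open>g\<close> with domain \<open>M\<close>. An object of the total category is a set with a predicate on
  it, and an arrow is a function \<open>g : M \<rightarrow> N\<close> with \<open>p \<le> g\<^sup>* q\<close>.
\<close>

definition fib_of_preds ::
  "'u set set \<Rightarrow> ('u set \<Rightarrow> 'p set) \<Rightarrow> ('u set \<Rightarrow> 'p \<Rightarrow> 'p \<Rightarrow> bool)
    \<Rightarrow> ('u set \<Rightarrow> ('u \<Rightarrow> 'u) \<Rightarrow> 'p \<Rightarrow> 'p)
    \<Rightarrow> ('u set \<times> 'p, 'u \<Rightarrow> 'u, 'u set, 'u \<Rightarrow> 'u) over" where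
  "fib_of_preds U Pr le re =
     \<lparr>total =
        \<lparr>Obj = {(M, p). M \<in> U \<and> p \<in> Pr M},
         Hom = (\<lambda>(M, p) (N, q). {g \<in> M \<rightarrow>\<^sub>E N. le M p (re M g q)}),
         Id = (\<lambda>(M, p). \<lambda>m\<in>M. m),
         Comp = (\<lambda>(L, p) (M, q) (N, r) g f. compose L g f)\<rparr>,
      proj = \<lparr>fob = fst, farr = (\<lambda>X Y g. g)\<rparr>\<rparr>"

text \<open>
  \<open>SPred i \<phi>\<close> is the predicate \<open>(i, \<phi>)\<close> of a uniform preorder, and \<open>FPred \<phi>\<close> the predicate \<open>\<phi>\<close> of a
  preorder. They share a type so that both constructions land in the same \<open>PFib\<close>.
\<close>

datatype 'u pred = SPred 'u "'u \<Rightarrow> 'u" | FPred "'u \<Rightarrow> 'u"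

definition ufam_preds :: "'u uord \<Rightarrow> 'u set \<Rightarrow> 'u pred set" where
  "ufam_preds X M = {SPred i \<phi> | i \<phi>. i \<in> sorts X \<and> \<phi> \<in> M \<rightarrow>\<^sub>E car X i}"

fun ufam_le :: "'u uord \<Rightarrow> 'u set \<Rightarrow> 'u pred \<Rightarrow> 'u pred \<Rightarrow> bool" where
  "ufam_le X M (SPred i \<phi>) (SPred j \<psi>) \<longleftrightarrow> {(\<phi> m, \<psi> m) | m. m \<in> M} \<in> rels X i j"
| "ufam_le X M _ _ \<longleftrightarrow> False"

definition fam_preds :: "'u set \<times> ('u \<times> 'u) set \<Rightarrow> 'u set \<Rightarrow> 'u pred set" where
  "fam_preds D M = {FPred \<phi> | \<phi>. \<phi> \<in> M \<rightarrow>\<^sub>E fst D}"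

fun fam_le :: "'u set \<times> ('u \<times> 'u) set \<Rightarrow> 'u set \<Rightarrow> 'u pred \<Rightarrow> 'u pred \<Rightarrow> bool" where
  "fam_le D M (FPred \<phi>) (FPred \<psi>) \<longleftrightarrow> (\<forall>m\<in>M. (\<phi> m, \<psi> m) \<in> snd D)"
| "fam_le D M _ _ \<longleftrightarrow> False"

fun precomp :: "'u set \<Rightarrow> ('u \<Rightarrow> 'u) \<Rightarrow> 'u pred \<Rightarrow> 'u pred" where
  "precomp M g (SPred i \<phi>) = SPred i (compose M \<phi> g)"
| "precomp M g (FPred \<phi>) = FPred (compose M \<phi> g)"

fun ufam_act :: "('u \<Rightarrow> 'u) \<times> ('u \<Rightarrow> 'u \<Rightarrow> 'u) \<Rightarrow> 'u set \<times> 'u pred \<Rightarrow> 'u set \<times> 'u pred" where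
  "ufam_act (u, f) (M, SPred i \<phi>) = (M, SPred (u i) (compose M (f i) \<phi>))"
| "ufam_act _ X = X"

fun fam_act :: "('u \<Rightarrow> 'u) \<Rightarrow> 'u set \<times> 'u pred \<Rightarrow> 'u set \<times> 'u pred" where
  "fam_act f (M, FPred \<phi>) = (M, FPred (compose M f \<phi>))"
| "fam_act _ X = X"

type_synonym 'u pfib = "('u set \<times> 'u pred, 'u \<Rightarrow> 'u, 'u set, 'u \<Rightarrow> 'u) over"
type_synonym 'u fibmap = "('u set \<times> 'u pred, 'u \<Rightarrow> 'u, 'u set \<times> 'u pred, 'u \<Rightarrow> 'u) ftor"

definition ufam_ob :: "'u set set \<Rightarrow> 'u uord \<Rightarrow> 'u pfib" where
  "ufam_ob U X = fib_of_preds U (ufam_preds X) (ufam_le X) precomp"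

definition fam_ob :: "'u set set \<Rightarrow> 'u set \<times> ('u \<times> 'u) set \<Rightarrow> 'u pfib" where
  "fam_ob U D = fib_of_preds U (fam_preds D) (fam_le D) precomp"

definition ufam ::
  "'u set set \<Rightarrow> ('u uord, ('u \<Rightarrow> 'u) \<times> ('u \<Rightarrow> 'u \<Rightarrow> 'u), 'u pfib, 'u fibmap) ftor" where
  "ufam U =
     \<lparr>fob = ufam_ob U,
      farr = (\<lambda>X Y h. mk_ftor (total (ufam_ob U X)) (ufam_act h) (\<lambda>p q g. g))\<rparr>"

definition fam ::
  "'u set set \<Rightarrow> ('u set \<times> ('u \<times> 'u) set, 'u \<Rightarrow> 'u, 'u pfib, 'u fibmap) ftor" where
  "fam U =
     \<lparr>fob = fam_ob U,
      farr = (\<lambda>D E h. mk_ftor (total (fam_ob U D)) (fam_act h) (\<lambda>p q g. g))\<rparr>"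

end

theory Submission
  imports Defs
begin

text \<open>
  A predicate \<open>(i, \<phi>)\<close> of \<open>ufam X\<close> is the reindexing along \<open>\<phi>\<close> of the generic predicate \<open>(i, id)\<close> on
  \<open>A\<^sub>i\<close>. Hence a fibered functor \<open>F\<close> out of \<open>ufam X\<close> is determined up to isomorphism by the images
  \<open>(u i, f\<^sub>i)\<close> of the generic predicates, and inequalities of fibered functors can be tested on them.
  The pair \<open>(u, f)\<close> is a monotone map: a relation \<open>r \<in> R\<^sub>i\<^sub>j\<close> is the joint image of its two
  projections, coded as functions on a small set, and \<open>F\<close> preserves the resulting inequality between
  the reindexings of the generic predicates along the projections. The statement on \<open>fam\<close> follows
  because local equivalences compose and can be transported along isomorphisms of 2-functors.
\<close>

section \<open>Categories and functors\<close>

text \<open>Two kinds of compatibility with reindexing have to be kept apart. Functors built from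
  monotone maps commute with it strictly, by associativity of composition; an arbitrary 1-cell
  \<open>F\<close> of \<open>PFib\<close> merely preserves cartesian arrows. The criterion
  \<open>cartesian_fib\<close> turns the latter into two opposite inequalities, so \<open>F\<close>
  is recovered only up to equivalence: its value at a predicate of sort \<open>i\<close> may have a
  sort other than the one dictated by the generic predicate. Smallness is what makes the test
  objects available: carriers lie in \<open>U\<close>, so generic predicates exist, and
  \<open>U\<close> contains coded products, so a relation can serve as the index set of two
  predicates. The triangle commutes up to isomorphism and not strictly because predicates of
  \<open>ufam\<close> still carry a sort when there is only one. Retagging them is a strict
  isomorphism of fibrations.\<close>

lemma categoryI:
  assumes "\<And>X. X \<in> Obj C \<Longrightarrow> Id C X \<in> Hom C X X"
    and "\<And>X Y Z f g. X \<in> Obj C \<Longrightarrow> Y \<in> Obj C \<Longrightarrow> Z \<in> Obj C \<Longrightarrow> f \<in> Hom C X Y \<Longrightarrow> g \<in> Hom C Y Z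
      \<Longrightarrow> Comp C X Y Z g f \<in> Hom C X Z"
    and "\<And>X Y f. X \<in> Obj C \<Longrightarrow> Y \<in> Obj C \<Longrightarrow> f \<in> Hom C X Y \<Longrightarrow> Comp C X X Y f (Id C X) = f"
    and "\<And>X Y f. X \<in> Obj C \<Longrightarrow> Y \<in> Obj C \<Longrightarrow> f \<in> Hom C X Y \<Longrightarrow> Comp C X Y Y (Id C Y) f = f"
    and "\<And>W X Y Z f g h. W \<in> Obj C \<Longrightarrow> X \<in> Obj C \<Longrightarrow> Y \<in> Obj C \<Longrightarrow> Z \<in> Obj C
      \<Longrightarrow> f \<in> Hom C W X \<Longrightarrow> g \<in> Hom C X Y \<Longrightarrow> h \<in> Hom C Y Z
      \<Longrightarrow> Comp C W X Z (Comp C X Y Z h g) f = Comp C W Y Z h (Comp C W X Y g f)"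
  shows "category C"
  using assms unfolding category_def by simp

lemma category_Id: "category C \<Longrightarrow> X \<in> Obj C \<Longrightarrow> Id C X \<in> Hom C X X"
  by (simp add: category_def)

lemma category_Comp:
  "category C \<Longrightarrow> X \<in> Obj C \<Longrightarrow> Y \<in> Obj C \<Longrightarrow> Z \<in> Obj C \<Longrightarrow> f \<in> Hom C X Y \<Longrightarrow> g \<in> Hom C Y Z
    \<Longrightarrow> Comp C X Y Z g f \<in> Hom C X Z"
  by (simp add: category_def)

lemma category_Comp_Id:
  "category C \<Longrightarrow> X \<in> Obj C \<Longrightarrow> Y \<in> Obj C \<Longrightarrow> f \<in> Hom C X Y \<Longrightarrow> Comp C X X Y f (Id C X) = f"
  "category C \<Longrightarrow> X \<in> Obj C \<Longrightarrow> Y \<in> Obj C \<Longrightarrow> f \<in> Hom C X Y \<Longrightarrow> Comp C X Y Y (Id C Y) f = f"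
  by (simp_all add: category_def)

lemma category_assoc:
  "category C \<Longrightarrow> W \<in> Obj C \<Longrightarrow> X \<in> Obj C \<Longrightarrow> Y \<in> Obj C \<Longrightarrow> Z \<in> Obj C
    \<Longrightarrow> f \<in> Hom C W X \<Longrightarrow> g \<in> Hom C X Y \<Longrightarrow> h \<in> Hom C Y Z
    \<Longrightarrow> Comp C W X Z (Comp C X Y Z h g) f = Comp C W Y Z h (Comp C W X Y g f)"
  by (simp add: category_def)

lemma functor_category:
  "is_functor C D F \<Longrightarrow> category C"
  "is_functor C D F \<Longrightarrow> category D"
  by (simp_all add: is_functor_def)

lemma functor_fob: "is_functor C D F \<Longrightarrow> X \<in> Obj C \<Longrightarrow> fob F X \<in> Obj D"
  by (simp add: is_functor_def)

lemma functor_farr: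
  "is_functor C D F \<Longrightarrow> X \<in> Obj C \<Longrightarrow> Y \<in> Obj C \<Longrightarrow> f \<in> Hom C X Y
    \<Longrightarrow> farr F X Y f \<in> Hom D (fob F X) (fob F Y)"
  by (simp add: is_functor_def)

lemma functor_Id: "is_functor C D F \<Longrightarrow> X \<in> Obj C \<Longrightarrow> farr F X X (Id C X) = Id D (fob F X)"
  by (simp add: is_functor_def)

lemma functor_Comp:
  "is_functor C D F \<Longrightarrow> X \<in> Obj C \<Longrightarrow> Y \<in> Obj C \<Longrightarrow> Z \<in> Obj C \<Longrightarrow> f \<in> Hom C X Y \<Longrightarrow> g \<in> Hom C Y Z
    \<Longrightarrow> farr F X Z (Comp C X Y Z g f) =
        Comp D (fob F X) (fob F Y) (fob F Z) (farr F Y Z g) (farr F X Y f)"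
  by (simp add: is_functor_def)

lemma fob_mk_ftor [simp]: "X \<in> Obj C \<Longrightarrow> fob (mk_ftor C F0 F1) X = F0 X"
  by (simp add: mk_ftor_def)

lemma farr_mk_ftor [simp]:
  "X \<in> Obj C \<Longrightarrow> Y \<in> Obj C \<Longrightarrow> f \<in> Hom C X Y \<Longrightarrow> farr (mk_ftor C F0 F1) X Y f = F1 X Y f"
  by (simp add: mk_ftor_def)

lemma ext_mk_ftor [simp]: "ext_ftor C (mk_ftor C F0 F1)"
  by (simp add: ext_ftor_def mk_ftor_def)

lemma ext_id_ftor [simp]: "ext_ftor C (id_ftor C)"
  by (simp add: id_ftor_def)

lemma ext_comp_ftor [simp]: "ext_ftor C (comp_ftor C G F)"
  by (simp add: comp_ftor_def)

text \<open>\<open>farr\<close> is extensional in three nested layers (source, target, arrow), so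
  agreement inside the domain is spread outwards one layer at a time. Equations between 1-cells of
  \<open>PFib\<close> thereby become strict equalities of records.\<close>

lemma ext_ftor_eqI:
  assumes F: "ext_ftor C F" and G: "ext_ftor C G"
    and fob: "\<And>X. X \<in> Obj C \<Longrightarrow> fob F X = fob G X"
    and farr: "\<And>X Y f. X \<in> Obj C \<Longrightarrow> Y \<in> Obj C \<Longrightarrow> f \<in> Hom C X Y \<Longrightarrow> farr F X Y f = farr G X Y f"
  shows "F = G"
proof (rule ftor.equality)
  show "fob F = fob G"
    using F G fob unfolding ext_ftor_def by (metis extensionalityI)
  have "farr F X Y = farr G X Y" if "X \<in> Obj C" "Y \<in> Obj C" for X Y
    using F G farr that unfolding ext_ftor_def by (metis extensionalityI)
  then have "farr F X = farr G X" if "X \<in> Obj C" for X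
    using F G that unfolding ext_ftor_def by (metis extensionalityI)
  then show "farr F = farr G"
    using F G unfolding ext_ftor_def by (metis extensionalityI)
qed simp

lemma is_functor_id: "category C \<Longrightarrow> is_functor C C (id_ftor C)"
  by (simp add: is_functor_def id_ftor_def category_Id category_Comp)

lemma is_functor_comp:
  "is_functor C D F \<Longrightarrow> is_functor D E G \<Longrightarrow> is_functor C E (comp_ftor C G F)"
  unfolding is_functor_def[of C E]
  by (simp add: comp_ftor_def category_Id category_Comp
      functor_category[where F = F] functor_category[where F = G]
      functor_fob[where F = F] functor_fob[where F = G]
      functor_farr[where F = F] functor_farr[where F = G]
      functor_Id[where F = F] functor_Id[where F = G]
      functor_Comp[where F = F] functor_Comp[where F = G])

lemma mk_ftor_cong: "(\<And>X. X \<in> Obj C \<Longrightarrow> F0 X = G0 X) \<Longrightarrow> mk_ftor C F0 F1 = mk_ftor C G0 F1"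
  by (rule ext_ftor_eqI[of C]) simp_all

text \<open>The concrete functors below leave the underlying arrow unchanged, so composing them only
  composes object parts. The functor hypothesis keeps the intermediate objects and arrows in the
  domain on which the outer functor is specified.\<close>

lemma comp_mk_ftor:
  assumes "is_functor C D (mk_ftor C F0 (\<lambda>X Y f. f))"
  shows "comp_ftor C (mk_ftor D G0 (\<lambda>X Y f. f)) (mk_ftor C F0 (\<lambda>X Y f. f)) =
    mk_ftor C (\<lambda>X. G0 (F0 X)) (\<lambda>X Y f. f)"
  using functor_fob[OF assms] functor_farr[OF assms]
  by (intro ext_ftor_eqI[of C]) (simp_all add: comp_ftor_def)

section \<open>Locally preordered categories\<close>

lemma lpcategoryI:
  assumes "category C"
    and "\<And>X Y f. X \<in> Obj C \<Longrightarrow> Y \<in> Obj C \<Longrightarrow> f \<in> Hom C X Y \<Longrightarrow> Le C X Y f f"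
    and "\<And>X Y f g h. X \<in> Obj C \<Longrightarrow> Y \<in> Obj C \<Longrightarrow> f \<in> Hom C X Y \<Longrightarrow> g \<in> Hom C X Y \<Longrightarrow> h \<in> Hom C X Y
      \<Longrightarrow> Le C X Y f g \<Longrightarrow> Le C X Y g h \<Longrightarrow> Le C X Y f h"
    and "\<And>X Y Z f f' g g'. X \<in> Obj C \<Longrightarrow> Y \<in> Obj C \<Longrightarrow> Z \<in> Obj C
      \<Longrightarrow> f \<in> Hom C X Y \<Longrightarrow> f' \<in> Hom C X Y \<Longrightarrow> g \<in> Hom C Y Z \<Longrightarrow> g' \<in> Hom C Y Z
      \<Longrightarrow> Le C X Y f f' \<Longrightarrow> Le C Y Z g g'
      \<Longrightarrow> Le C X Z (Comp C X Y Z g f) (Comp C X Y Z g' f')"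
  shows "lpcategory C"
  unfolding lpcategory_def by (intro conjI ballI impI) (rule assms; assumption)+

lemma lpcategory_category: "lpcategory C \<Longrightarrow> category C"
  by (simp add: lpcategory_def)

lemma Le_trans:
  "lpcategory C \<Longrightarrow> X \<in> Obj C \<Longrightarrow> Y \<in> Obj C \<Longrightarrow> f \<in> Hom C X Y \<Longrightarrow> g \<in> Hom C X Y \<Longrightarrow> h \<in> Hom C X Y
    \<Longrightarrow> Le C X Y f g \<Longrightarrow> Le C X Y g h \<Longrightarrow> Le C X Y f h"
  unfolding lpcategory_def by blast

lemma Le_whisker:
  assumes "lpcategory C" "X \<in> Obj C" "Y \<in> Obj C" "Z \<in> Obj C"
  shows "f \<in> Hom C X Y \<Longrightarrow> f' \<in> Hom C X Y \<Longrightarrow> g \<in> Hom C Y Z \<Longrightarrow> Le C X Y f f'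
      \<Longrightarrow> Le C X Z (Comp C X Y Z g f) (Comp C X Y Z g f')"
    and "f \<in> Hom C X Y \<Longrightarrow> g \<in> Hom C Y Z \<Longrightarrow> g' \<in> Hom C Y Z \<Longrightarrow> Le C Y Z g g'
      \<Longrightarrow> Le C X Z (Comp C X Y Z g f) (Comp C X Y Z g' f)"
  using assms unfolding lpcategory_def by blast+

lemma two_functor_functor: "two_functor C D F \<Longrightarrow> is_functor C D F"
  by (simp add: two_functor_def)

lemma two_functor_lpcategory:
  "two_functor C D F \<Longrightarrow> lpcategory C"
  "two_functor C D F \<Longrightarrow> lpcategory D"
  by (simp_all add: two_functor_def)

lemma two_functor_Le:
  "two_functor C D F \<Longrightarrow> X \<in> Obj C \<Longrightarrow> Y \<in> Obj C \<Longrightarrow> f \<in> Hom C X Y \<Longrightarrow> g \<in> Hom C X Y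
    \<Longrightarrow> Le C X Y f g \<Longrightarrow> Le D (fob F X) (fob F Y) (farr F X Y f) (farr F X Y g)"
  by (simp add: two_functor_def)

lemma two_functor_comp:
  assumes F: "two_functor C D F" and G: "two_functor D E G"
  shows "two_functor C E (comp_ftor C G F)"
  unfolding two_functor_def[of C E]
  using is_functor_comp[OF F[THEN two_functor_functor] G[THEN two_functor_functor]]
    two_functor_lpcategory[OF F] two_functor_lpcategory[OF G]
    two_functor_Le[OF F] two_functor_Le[OF G]
    functor_fob[OF two_functor_functor[OF F]] functor_farr[OF two_functor_functor[OF F]]
  by (simp add: comp_ftor_def)

lemma local_equivalence_two_functor: "local_equivalence C D F \<Longrightarrow> two_functor C D F"
  by (simp add: local_equivalence_def)

lemma local_equivalence_reflects:
  "local_equivalence C D F \<Longrightarrow> X \<in> Obj C \<Longrightarrow> Y \<in> Obj C \<Longrightarrow> f \<in> Hom C X Y \<Longrightarrow> g \<in> Hom C X Y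
    \<Longrightarrow> Le D (fob F X) (fob F Y) (farr F X Y f) (farr F X Y g) \<Longrightarrow> Le C X Y f g"
  by (simp add: local_equivalence_def)

lemma local_equivalence_surj:
  assumes "local_equivalence C D F" "X \<in> Obj C" "Y \<in> Obj C" "h \<in> Hom D (fob F X) (fob F Y)"
  obtains f where "f \<in> Hom C X Y" "Le D (fob F X) (fob F Y) (farr F X Y f) h"
    "Le D (fob F X) (fob F Y) h (farr F X Y f)"
  using assms unfolding local_equivalence_def by blast

text \<open>Lift \<open>h\<close> along \<open>G\<close> to \<open>k\<close>, then \<open>k\<close>
  along \<open>F\<close> to \<open>f\<close>. The 2-functor \<open>G\<close> preserves the
  equivalence between \<open>k\<close> and the image of \<open>f\<close>, and the image of
  \<open>k\<close> is equivalent to \<open>h\<close>.\<close>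

lemma local_equivalence_comp:
  assumes F: "local_equivalence C D F" and G: "local_equivalence D E G"
  shows "local_equivalence C E (comp_ftor C G F)"
proof -
  note F2 = local_equivalence_two_functor[OF F] and G2 = local_equivalence_two_functor[OF G]
  note ob = functor_fob[OF two_functor_functor[OF F2]]
    functor_fob[OF two_functor_functor[OF G2]]
  note ar = functor_farr[OF two_functor_functor[OF F2]]
    functor_farr[OF two_functor_functor[OF G2]]
  have surj: "\<exists>f\<in>Hom C X Y.
      Le E (fob G (fob F X)) (fob G (fob F Y)) (farr G (fob F X) (fob F Y) (farr F X Y f)) h \<and>
      Le E (fob G (fob F X)) (fob G (fob F Y)) h (farr G (fob F X) (fob F Y) (farr F X Y f))"
    if XY: "X \<in> Obj C" "Y \<in> Obj C" and h: "h \<in> Hom E (fob G (fob F X)) (fob G (fob F Y))" for X Y h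
  proof -
    obtain k where k: "k \<in> Hom D (fob F X) (fob F Y)"
        "Le E (fob G (fob F X)) (fob G (fob F Y)) (farr G (fob F X) (fob F Y) k) h"
        "Le E (fob G (fob F X)) (fob G (fob F Y)) h (farr G (fob F X) (fob F Y) k)"
      using local_equivalence_surj[OF G ob(1) ob(1) h] XY by blast
    obtain f where f: "f \<in> Hom C X Y" "Le D (fob F X) (fob F Y) (farr F X Y f) k"
        "Le D (fob F X) (fob F Y) k (farr F X Y f)"
      using local_equivalence_surj[OF F XY k(1)] by blast
    note GX = ob(2)[OF ob(1)[OF XY(1)]] and GY = ob(2)[OF ob(1)[OF XY(2)]]
    note Fh = ar(1)[OF XY] and Gh = ar(2)[OF ob(1)[OF XY(1)] ob(1)[OF XY(2)]]
    note G_Le = two_functor_Le[OF G2 ob(1)[OF XY(1)] ob(1)[OF XY(2)]]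
    note trans = Le_trans[OF two_functor_lpcategory(2)[OF G2] GX GY]
    show ?thesis
      using trans[OF Gh[OF Fh[OF f(1)]] Gh[OF k(1)] h G_Le[OF Fh[OF f(1)] k(1) f(2)] k(2)]
        trans[OF h Gh[OF k(1)] Gh[OF Fh[OF f(1)]] k(3) G_Le[OF k(1) Fh[OF f(1)] f(3)]] f(1)
      by blast
  qed
  show ?thesis
    unfolding local_equivalence_def[of C E]
    using two_functor_comp[OF F2 G2] surj local_equivalence_reflects[OF F]
      local_equivalence_reflects[OF G] ob ar
    by (simp add: comp_ftor_def)
qed

text \<open>Conjugation with the components of \<eta> is monotone in both directions between the
  homs seen by \<open>F\<close> and by \<open>G\<close>, and naturality says that it exchanges the
  images of each \<open>f\<close>. Both halves of local equivalence travel along it.\<close>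

lemma local_equivalence_isomorphic:
  assumes F: "local_equivalence C D F" and iso: "two_functors_isomorphic C D F G"
  shows "local_equivalence C D G"
proof -
  have F2: "two_functor C D F" and G2: "two_functor C D G"
    using iso by (simp_all add: two_functors_isomorphic_def)
  note Ff = two_functor_functor[OF F2] and Gf = two_functor_functor[OF G2]
  note D = two_functor_lpcategory(2)[OF F2]
  note Dc = lpcategory_category[OF D]
  obtain \<eta> where \<eta>: "\<And>X. X \<in> Obj C \<Longrightarrow> iso_arrow D (fob F X) (fob G X) (\<eta> X)"
    and nat: "\<And>X Y f. X \<in> Obj C \<Longrightarrow> Y \<in> Obj C \<Longrightarrow> f \<in> Hom C X Y \<Longrightarrow>
          Comp D (fob F X) (fob F Y) (fob G Y) (\<eta> Y) (farr F X Y f) =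
          Comp D (fob F X) (fob G X) (fob G Y) (farr G X Y f) (\<eta> X)"
    using iso unfolding two_functors_isomorphic_def by blast
  have main: "(\<forall>f\<in>Hom C X Y. \<forall>g\<in>Hom C X Y.
           Le D (fob G X) (fob G Y) (farr G X Y f) (farr G X Y g) \<longrightarrow> Le C X Y f g) \<and>
        (\<forall>h\<in>Hom D (fob G X) (fob G Y). \<exists>f\<in>Hom C X Y.
           Le D (fob G X) (fob G Y) (farr G X Y f) h \<and>
           Le D (fob G X) (fob G Y) h (farr G X Y f))"
    if X: "X \<in> Obj C" and Y: "Y \<in> Obj C" for X Y
  proof -
    note FX = functor_fob[OF Ff X] and FY = functor_fob[OF Ff Y]
      and GX = functor_fob[OF Gf X] and GY = functor_fob[OF Gf Y]
    note Fh = functor_farr[OF Ff X Y] and Gh = functor_farr[OF Gf X Y]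
    have eX: "\<eta> X \<in> Hom D (fob F X) (fob G X)" and eY: "\<eta> Y \<in> Hom D (fob F Y) (fob G Y)"
      using \<eta> X Y by (simp_all add: iso_arrow_def)
    obtain x where x: "x \<in> Hom D (fob G X) (fob F X)"
        "Comp D (fob F X) (fob G X) (fob F X) x (\<eta> X) = Id D (fob F X)"
        "Comp D (fob G X) (fob F X) (fob G X) (\<eta> X) x = Id D (fob G X)"
      using \<eta>[OF X] by (auto simp: iso_arrow_def)
    obtain y where y: "y \<in> Hom D (fob G Y) (fob F Y)"
        "Comp D (fob F Y) (fob G Y) (fob F Y) y (\<eta> Y) = Id D (fob F Y)"
        "Comp D (fob G Y) (fob F Y) (fob G Y) (\<eta> Y) y = Id D (fob G Y)"
      using \<eta>[OF Y] by (auto simp: iso_arrow_def)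
    \<comment> \<open>Conjugation: \<open>x\<close> and \<open>y\<close> are the inverses of
      \<open>\<eta> X\<close> and \<open>\<eta> Y\<close>.\<close>
    define toF where "toF k = Comp D (fob F X) (fob G Y) (fob F Y) y
      (Comp D (fob F X) (fob G X) (fob G Y) k (\<eta> X))" for k
    define toG where "toG k = Comp D (fob G X) (fob F X) (fob G Y)
      (Comp D (fob F X) (fob F Y) (fob G Y) (\<eta> Y) k) x" for k
    have toF: "toF k \<in> Hom D (fob F X) (fob F Y)" if "k \<in> Hom D (fob G X) (fob G Y)" for k
      unfolding toF_def using that FX FY GX GY eX y by (simp add: category_Comp[OF Dc])
    have toG: "toG k \<in> Hom D (fob G X) (fob G Y)" if "k \<in> Hom D (fob F X) (fob F Y)" for k
      unfolding toG_def using that FX FY GX GY eY x by (simp add: category_Comp[OF Dc])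
    have toF_farr: "toF (farr G X Y f) = farr F X Y f" if f: "f \<in> Hom C X Y" for f
    proof -
      have "toF (farr G X Y f) = Comp D (fob F X) (fob G Y) (fob F Y) y
        (Comp D (fob F X) (fob F Y) (fob G Y) (\<eta> Y) (farr F X Y f))"
        using f X Y by (simp add: toF_def nat)
      also have "\<dots> = Comp D (fob F X) (fob F Y) (fob F Y)
        (Comp D (fob F Y) (fob G Y) (fob F Y) y (\<eta> Y)) (farr F X Y f)"
        using FX FY GY Fh[OF f] eY y(1) by (simp add: category_assoc[OF Dc])
      finally show ?thesis
        using FX FY Fh[OF f] by (simp add: y(2) category_Comp_Id[OF Dc])
    qed
    have toG_farr: "toG (farr F X Y f) = farr G X Y f" if f: "f \<in> Hom C X Y" for f
    proof -
      have "toG (farr F X Y f) = Comp D (fob G X) (fob F X) (fob G Y)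
        (Comp D (fob F X) (fob G X) (fob G Y) (farr G X Y f) (\<eta> X)) x"
        using f X Y by (simp add: toG_def nat)
      also have "\<dots> = Comp D (fob G X) (fob G X) (fob G Y) (farr G X Y f)
        (Comp D (fob G X) (fob F X) (fob G X) (\<eta> X) x)"
        using FX GX GY Gh[OF f] eX x(1) by (simp add: category_assoc[OF Dc])
      finally show ?thesis
        using GX GY Gh[OF f] by (simp add: x(3) category_Comp_Id[OF Dc])
    qed
    \<comment> \<open>A 1-cell approximating \<open>toF h\<close> has to be carried back to one
      approximating \<open>h\<close>; this cancellation allows it. Order reflection rests on
      \<open>toF_farr\<close> and \<open>toF_Le\<close>.\<close>
    have toG_toF: "toG (toF h) = h" if h: "h \<in> Hom D (fob G X) (fob G Y)" for h
    proof -
      let ?k = "Comp D (fob F X) (fob G X) (fob G Y) h (\<eta> X)"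
      have k: "?k \<in> Hom D (fob F X) (fob G Y)"
        using h FX GX GY eX by (simp add: category_Comp[OF Dc])
      have "Comp D (fob F X) (fob F Y) (fob G Y) (\<eta> Y) (toF h) =
        Comp D (fob F X) (fob G Y) (fob G Y) (Comp D (fob G Y) (fob F Y) (fob G Y) (\<eta> Y) y) ?k"
        using k FX FY GY y(1) eY by (simp add: toF_def category_assoc[OF Dc])
      also have "\<dots> = ?k"
        using k FX GY by (simp add: y(3) category_Comp_Id[OF Dc])
      finally have "toG (toF h) = Comp D (fob G X) (fob G X) (fob G Y) h
        (Comp D (fob G X) (fob F X) (fob G X) (\<eta> X) x)"
        using h FX GX GY eX x(1) by (simp add: toG_def category_assoc[OF Dc])
      then show ?thesis
        using h GX GY by (simp add: x(3) category_Comp_Id[OF Dc])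
    qed
    have toF_Le: "Le D (fob F X) (fob F Y) (toF h) (toF k)"
      if "h \<in> Hom D (fob G X) (fob G Y)" "k \<in> Hom D (fob G X) (fob G Y)"
        "Le D (fob G X) (fob G Y) h k" for h k
      unfolding toF_def
      using that FX FY GX GY eX y(1)
      by (intro Le_whisker[OF D] category_Comp[OF Dc])
    have toG_Le: "Le D (fob G X) (fob G Y) (toG h) (toG k)"
      if "h \<in> Hom D (fob F X) (fob F Y)" "k \<in> Hom D (fob F X) (fob F Y)"
        "Le D (fob F X) (fob F Y) h k" for h k
      unfolding toG_def
      using that FX FY GX GY eY x(1)
      by (intro Le_whisker[OF D] category_Comp[OF Dc])
    have "\<exists>f\<in>Hom C X Y. Le D (fob G X) (fob G Y) (farr G X Y f) h \<and>
           Le D (fob G X) (fob G Y) h (farr G X Y f)" if h: "h \<in> Hom D (fob G X) (fob G Y)" for h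
    proof -
      obtain f where f: "f \<in> Hom C X Y" "Le D (fob F X) (fob F Y) (farr F X Y f) (toF h)"
          "Le D (fob F X) (fob F Y) (toF h) (farr F X Y f)"
        using local_equivalence_surj[OF F X Y toF[OF h]] by blast
      have "Le D (fob G X) (fob G Y) (farr G X Y f) h"
        using toG_Le[OF Fh[OF f(1)] toF[OF h] f(2)] f(1) h by (simp add: toG_farr toG_toF)
      moreover have "Le D (fob G X) (fob G Y) h (farr G X Y f)"
        using toG_Le[OF toF[OF h] Fh[OF f(1)] f(3)] f(1) h by (simp add: toG_farr toG_toF)
      ultimately show ?thesis using f(1) by blast
    qed
    moreover have "Le C X Y f g" if "f \<in> Hom C X Y" "g \<in> Hom C X Y"
        "Le D (fob G X) (fob G Y) (farr G X Y f) (farr G X Y g)" for f g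
      using toF_Le[OF Gh Gh] that local_equivalence_reflects[OF F X Y] by (simp add: toF_farr)
    ultimately show ?thesis by blast
  qed
  show ?thesis
    unfolding local_equivalence_def using G2 main by blast
qed

section \<open>Posetal fibrations\<close>

lemma PFib_simps:
  "P \<in> Obj (PFib B) \<longleftrightarrow> posetal_fibration B P"
  "F \<in> Hom (PFib B) P Q \<longleftrightarrow> fibered_functor B P Q F \<and> ext_ftor (total P) F"
  "Id (PFib B) P = id_ftor (total P)"
  "Comp (PFib B) P Q R G F = comp_ftor (total P) G F"
  "Le (PFib B) P Q F G \<longleftrightarrow> (\<forall>X\<in>Obj (total P). fiber_le B Q (fob F X) (fob G X))"
  by (simp_all add: PFib_def)

lemma posetal_fibration_functor: "posetal_fibration B P \<Longrightarrow> is_functor (total P) B (proj P)"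
  by (simp add: posetal_fibration_def fibration_def)

lemma fibered_functor_functor:
  "fibered_functor B P Q F \<Longrightarrow> is_functor (total P) (total Q) F"
  by (simp add: fibered_functor_def)

lemma fibered_functor_id: "category (total P) \<Longrightarrow> fibered_functor B P P (id_ftor (total P))"
  by (simp add: fibered_functor_def is_functor_id) (simp add: id_ftor_def cartesian_def)

lemma fibered_functor_comp:
  assumes F: "fibered_functor B P Q F" and G: "fibered_functor B Q R G"
  shows "fibered_functor B P R (comp_ftor (total P) G F)"
proof -
  note Ff = fibered_functor_functor[OF F] and Gf = fibered_functor_functor[OF G]
  note Fa = functor_fob[OF Ff] functor_farr[OF Ff]
  have "cartesian B R (fob G (fob F X)) (fob G (fob F Y))
      (farr (comp_ftor (total P) G F) X Y f)"
    if "X \<in> Obj (total P)" "Y \<in> Obj (total P)" "cartesian B P X Y f" for X Y f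
  proof -
    have "f \<in> Hom (total P) X Y"
      using that by (simp add: cartesian_def)
    then show ?thesis
      using that F G Fa by (simp add: fibered_functor_def comp_ftor_def)
  qed
  then show ?thesis
    using F G Fa is_functor_comp[OF Ff Gf]
    unfolding fibered_functor_def[of B P R] by (simp add: fibered_functor_def comp_ftor_def)
qed

lemma fiber_le_refl:
  assumes "is_functor (total P) B (proj P)" "X \<in> Obj (total P)"
  shows "fiber_le B P X X"
  unfolding fiber_le_def
  using functor_Id[OF assms] category_Id[OF functor_category(1)[OF assms(1)] assms(2)] by blast

lemma fiber_le_trans:
  assumes P: "is_functor (total P) B (proj P)"
    and X: "X \<in> Obj (total P)" and Y: "Y \<in> Obj (total P)" and Z: "Z \<in> Obj (total P)"
    and XY: "fiber_le B P X Y" and YZ: "fiber_le B P Y Z"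
  shows "fiber_le B P X Z"
proof -
  note cat = functor_category[OF P]
  obtain f where f: "f \<in> Hom (total P) X Y" "farr (proj P) X Y f = Id B (fob (proj P) X)"
    using XY by (auto simp: fiber_le_def)
  obtain g where g: "g \<in> Hom (total P) Y Z" "farr (proj P) Y Z g = Id B (fob (proj P) Y)"
    using YZ by (auto simp: fiber_le_def)
  have ob: "fob (proj P) X = fob (proj P) Y" "fob (proj P) Z = fob (proj P) Y"
    using XY YZ by (simp_all add: fiber_le_def)
  have "farr (proj P) X Z (Comp (total P) X Y Z g f) = Id B (fob (proj P) X)"
    using functor_Comp[OF P X Y Z f(1) g(1)] f g functor_fob[OF P Y] cat
    by (simp add: ob category_Comp_Id category_Id)
  then show ?thesis
    using category_Comp[OF cat(1) X Y Z f(1) g(1)] ob by (auto simp: fiber_le_def)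
qed

text \<open>\<open>F\<close> commutes strictly with the projections, so vertical arrows go to
  vertical arrows. In \<open>PFib\<close> this is monotonicity of postcomposition with
  \<open>F\<close>.\<close>

lemma fiber_le_fob:
  assumes F: "fibered_functor B P Q F" and X: "X \<in> Obj (total P)" and Y: "Y \<in> Obj (total P)"
    and XY: "fiber_le B P X Y"
  shows "fiber_le B Q (fob F X) (fob F Y)"
proof -
  obtain f where f: "f \<in> Hom (total P) X Y" "farr (proj P) X Y f = Id B (fob (proj P) X)"
    using XY by (auto simp: fiber_le_def)
  have "farr F X Y f \<in> Hom (total Q) (fob F X) (fob F Y)"
    using functor_farr[OF fibered_functor_functor[OF F]] X Y f(1) by blast
  then show ?thesis
    using F X Y f XY unfolding fiber_le_def fibered_functor_def by (metis (no_types))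
qed

lemma lpcategory_PFib: "lpcategory (PFib B)"
proof -
  have comp: "Comp (PFib B) P Q R G F \<in> Hom (PFib B) P R"
    if "F \<in> Hom (PFib B) P Q" "G \<in> Hom (PFib B) Q R" for P Q R F G
    using that fibered_functor_comp[of B P Q F R G] by (simp add: PFib_simps)
  have ftor: "is_functor (total P) (total Q) F" if "F \<in> Hom (PFib B) P Q" for P Q F
    using that by (simp add: PFib_simps fibered_functor_def)
  note ob = functor_fob[OF ftor] and ar = functor_farr[OF ftor]
  have cat: "category (total P)" if "P \<in> Obj (PFib B)" for P
    using that by (simp add: PFib_simps functor_category(1)[OF posetal_fibration_functor])
  have id: "Id (PFib B) P \<in> Hom (PFib B) P P" if "P \<in> Obj (PFib B)" for P
    using fibered_functor_id[OF cat[OF that]] by (simp add: PFib_simps)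
  have unit: "Comp (PFib B) P P Q F (Id (PFib B) P) = F"
      "Comp (PFib B) P Q Q (Id (PFib B) Q) F = F"
    if "F \<in> Hom (PFib B) P Q" for P Q F
    using that ob[OF that] ar[OF that]
    by - (rule ext_ftor_eqI[of "total P"]; simp add: PFib_simps comp_ftor_def id_ftor_def)+
  have assoc: "Comp (PFib B) P Q S (Comp (PFib B) Q R S H G) F =
      Comp (PFib B) P R S H (Comp (PFib B) P Q R G F)"
    if "F \<in> Hom (PFib B) P Q" "G \<in> Hom (PFib B) Q R" "H \<in> Hom (PFib B) R S" for P Q R S F G H
    using ob[OF that(1)] ar[OF that(1)]
    by (intro ext_ftor_eqI[of "total P"]) (simp_all add: PFib_simps comp_ftor_def)
  have C: "category (PFib B)"
    by (intro categoryI id comp unit assoc)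
  have refl: "Le (PFib B) P Q F F" if "Q \<in> Obj (PFib B)" "F \<in> Hom (PFib B) P Q" for P Q F
    using that ob[OF that(2)]
    by (auto simp: PFib_simps intro: fiber_le_refl posetal_fibration_functor)
  have trans: "Le (PFib B) P Q F H"
    if "Q \<in> Obj (PFib B)" "F \<in> Hom (PFib B) P Q" "G \<in> Hom (PFib B) P Q" "H \<in> Hom (PFib B) P Q"
      "Le (PFib B) P Q F G" "Le (PFib B) P Q G H" for P Q F G H
    using that ob[OF that(2)] ob[OF that(3)] ob[OF that(4)]
    by (simp add: PFib_simps) (metis fiber_le_trans posetal_fibration_functor)
  \<comment> \<open>The 2-cells are pasted through the value of \<open>G\<close> at
    \<open>fob F' X\<close>: the first inequality is the image of a vertical arrow under
    \<open>G\<close>, the second is the given one at the object \<open>fob F' X\<close>.\<close>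
  have mono: "Le (PFib B) P R (Comp (PFib B) P Q R G F) (Comp (PFib B) P Q R G' F')"
    if R: "R \<in> Obj (PFib B)" and F: "F \<in> Hom (PFib B) P Q" and F': "F' \<in> Hom (PFib B) P Q"
      and G: "G \<in> Hom (PFib B) Q R" and G': "G' \<in> Hom (PFib B) Q R"
      and le: "Le (PFib B) P Q F F'" "Le (PFib B) Q R G G'" for P Q R F F' G G'
  proof -
    have "fiber_le B R (fob G (fob F X)) (fob G' (fob F' X))" if X: "X \<in> Obj (total P)" for X
    proof (rule fiber_le_trans[OF posetal_fibration_functor])
      show "posetal_fibration B R"
        using R by (simp add: PFib_simps)
      show "fiber_le B R (fob G (fob F X)) (fob G (fob F' X))"
        using G le X ob[OF F X] ob[OF F' X] by (auto simp: PFib_simps intro: fiber_le_fob)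
      show "fiber_le B R (fob G (fob F' X)) (fob G' (fob F' X))"
        using le ob[OF F' X] by (simp add: PFib_simps)
    qed (use ob[OF F X] ob[OF F' X] ob[OF G] ob[OF G'] in auto)
    then show ?thesis
      by (simp add: PFib_simps comp_ftor_def)
  qed
  show ?thesis
    by (rule lpcategoryI[OF C]) (rule refl trans mono; assumption)+
qed

section \<open>The category of small sets, and fibrations from strictly indexed preorders\<close>

lemma set_cat_simps [simp]:
  "Obj (set_cat U) = U"
  "Hom (set_cat U) M N = (M \<rightarrow>\<^sub>E N)"
  "Id (set_cat U) M = (\<lambda>m\<in>M. m)"
  "Comp (set_cat U) L M N g f = compose L g f"
  by (simp_all add: set_cat_def)

lemma compose_PiE: "f \<in> L \<rightarrow>\<^sub>E M \<Longrightarrow> g \<in> M \<rightarrow>\<^sub>E N \<Longrightarrow> compose L g f \<in> L \<rightarrow>\<^sub>E N"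
  by (auto simp: compose_def)

lemma compose_Id_PiE:
  "f \<in> M \<rightarrow>\<^sub>E N \<Longrightarrow> compose M f (\<lambda>m\<in>M. m) = f"
  "f \<in> M \<rightarrow>\<^sub>E N \<Longrightarrow> compose M (\<lambda>n\<in>N. n) f = f"
  by (auto simp: PiE_def intro: compose_Id Id_compose)

lemma compose_assoc_PiE:
  "f \<in> L \<rightarrow>\<^sub>E M \<Longrightarrow> compose L (compose M h g) f = compose L h (compose L g f)"
  by (auto simp: PiE_def intro: compose_assoc[symmetric])

lemma category_set_cat: "category (set_cat U)"
  by (auto simp: category_def compose_PiE compose_Id_PiE compose_assoc_PiE)

text \<open>A strict contravariant functor from small sets to preorders; \<open>fib\<close> is its
  Grothendieck construction. \<open>re_Id\<close> and \<open>re_compose\<close> are equations (a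
  split fibration), as suits reindexing by precomposition of restricted functions.\<close>

locale indexed_preorder =
  fixes U :: "'u set set" and Pr :: "'u set \<Rightarrow> 'p set" and le :: "'u set \<Rightarrow> 'p \<Rightarrow> 'p \<Rightarrow> bool"
    and re :: "'u set \<Rightarrow> ('u \<Rightarrow> 'u) \<Rightarrow> 'p \<Rightarrow> 'p"
  assumes le_refl: "M \<in> U \<Longrightarrow> p \<in> Pr M \<Longrightarrow> le M p p"
    and le_trans: "M \<in> U \<Longrightarrow> p \<in> Pr M \<Longrightarrow> q \<in> Pr M \<Longrightarrow> r \<in> Pr M
      \<Longrightarrow> le M p q \<Longrightarrow> le M q r \<Longrightarrow> le M p r"
    and re_closed: "M \<in> U \<Longrightarrow> N \<in> U \<Longrightarrow> g \<in> M \<rightarrow>\<^sub>E N \<Longrightarrow> q \<in> Pr N \<Longrightarrow> re M g q \<in> Pr M"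
    and re_mono: "M \<in> U \<Longrightarrow> N \<in> U \<Longrightarrow> g \<in> M \<rightarrow>\<^sub>E N \<Longrightarrow> p \<in> Pr N \<Longrightarrow> q \<in> Pr N \<Longrightarrow> le N p q
      \<Longrightarrow> le M (re M g p) (re M g q)"
    and re_Id: "M \<in> U \<Longrightarrow> p \<in> Pr M \<Longrightarrow> re M (\<lambda>m\<in>M. m) p = p"
    and re_compose: "L \<in> U \<Longrightarrow> M \<in> U \<Longrightarrow> N \<in> U \<Longrightarrow> f \<in> L \<rightarrow>\<^sub>E M \<Longrightarrow> g \<in> M \<rightarrow>\<^sub>E N \<Longrightarrow> r \<in> Pr N
      \<Longrightarrow> re L (compose L g f) r = re L f (re M g r)"
begin

abbreviation fib :: "('u set \<times> 'p, 'u \<Rightarrow> 'u, 'u set, 'u \<Rightarrow> 'u) over" where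
  "fib \<equiv> fib_of_preds U Pr le re"

lemma fib_simps:
  "(M, p) \<in> Obj (total fib) \<longleftrightarrow> M \<in> U \<and> p \<in> Pr M"
  "g \<in> Hom (total fib) (M, p) (N, q) \<longleftrightarrow> g \<in> M \<rightarrow>\<^sub>E N \<and> le M p (re M g q)"
  "Id (total fib) (M, p) = (\<lambda>m\<in>M. m)"
  "Comp (total fib) (L, p) (M, q) (N, r) g f = compose L g f"
  "fob (proj fib) X = fst X"
  "farr (proj fib) X Y g = g"
  by (simp_all add: fib_of_preds_def)

lemma fib_Obj: "Obj (total fib) = {(M, p). M \<in> U \<and> p \<in> Pr M}"
  by (simp add: fib_of_preds_def)

text \<open>Composites exist because \<open>p\<close> below \<open>re L f q\<close> and
  \<open>q\<close> below \<open>re M g r\<close> combine, by monotonicity of \<open>re L f\<close>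
  and the strict composition law, to \<open>p\<close> below the reindexing of \<open>r\<close> along
  the composite.\<close>

lemma category_fib: "category (total fib)"
proof -
  have "le L p (re L (compose L g f) r)"
    if "L \<in> U" "M \<in> U" "N \<in> U" "p \<in> Pr L" "q \<in> Pr M" "r \<in> Pr N" "f \<in> L \<rightarrow>\<^sub>E M" "g \<in> M \<rightarrow>\<^sub>E N"
      "le L p (re L f q)" "le M q (re M g r)" for L M N p q r f g
    using le_trans[OF _ _ _ _ _ re_mono[of L M f q "re M g r"]] that
    by (simp add: re_compose re_closed)
  then show ?thesis
    by (intro categoryI)
      (auto simp: fib_Obj fib_simps compose_Id_PiE compose_assoc_PiE re_Id le_refl
        del: PiE_I intro: compose_PiE)
qed

lemma functor_fib: "is_functor (total fib) (set_cat U) (proj fib)"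
  unfolding is_functor_def
  by (auto simp: category_fib category_set_cat fib_Obj fib_simps)

text \<open>Reduces a universal property quantified over the whole total category to an equivalence
  in one fiber. Preservation of cartesian arrows thus becomes commutation with reindexing up to
  equivalence.\<close>

lemma cartesian_fib:
  assumes "M \<in> U" "p \<in> Pr M" "N \<in> U" "q \<in> Pr N"
  shows "cartesian (set_cat U) fib (M, p) (N, q) g \<longleftrightarrow>
    g \<in> M \<rightarrow>\<^sub>E N \<and> le M p (re M g q) \<and> le M (re M g q) p"
proof (intro iffI conjI; (elim conjE)?)
  assume c: "cartesian (set_cat U) fib (M, p) (N, q) g"
  then show g: "g \<in> M \<rightarrow>\<^sub>E N" and "le M p (re M g q)"
    by (simp_all add: cartesian_def fib_simps)
  have re: "re M g q \<in> Pr M"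
    using assms g by (simp add: re_closed)
  \<comment> \<open>The universal property is tested at \<open>(M, re M g q)\<close> over the
    identity of \<open>M\<close>. The factorization must be that identity, and its being an arrow is
    the missing inequality.\<close>
  have "\<exists>!k. k \<in> Hom (total fib) (M, re M g q) (M, p) \<and>
      farr (proj fib) (M, re M g q) (M, p) k = (\<lambda>m\<in>M. m) \<and>
      Comp (total fib) (M, re M g q) (M, p) (N, q) g k = g"
    using c[unfolded cartesian_def, THEN conjunct2, rule_format,
        of "(M, re M g q)" g "\<lambda>m\<in>M. m"] assms g re
    by (simp add: fib_simps le_refl compose_Id_PiE)
  then have "(\<lambda>m\<in>M. m) \<in> Hom (total fib) (M, re M g q) (M, p)"
    by (auto simp: fib_simps)
  then show "le M (re M g q) p"
    using assms by (simp add: fib_simps re_Id)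
next
  assume g: "g \<in> M \<rightarrow>\<^sub>E N" "le M p (re M g q)" "le M (re M g q) p"
  \<comment> \<open>Arrows are their own projections, so the factorization can only be
    \<open>v\<close>. That \<open>v\<close> is an arrow follows by rewriting the reindexing along
    the composite as \<open>re L v (re M g q)\<close> and then passing to \<open>p\<close>.\<close>
  have "le L r (re L v p)"
    if "L \<in> U" "r \<in> Pr L" "v \<in> L \<rightarrow>\<^sub>E M" "le L r (re L (compose L g v) q)" for L r v
    using le_trans[OF _ _ _ _ _ re_mono[of L M v "re M g q" p]] that assms g
    by (simp add: re_compose re_closed)
  then show "cartesian (set_cat U) fib (M, p) (N, q) g"
    using g by (auto simp: cartesian_def fib_Obj fib_simps)
qed

lemma posetal_fibration_fib: "posetal_fibration (set_cat U) fib"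
proof -
  have "\<exists>X\<in>Obj (total fib). \<exists>f. cartesian (set_cat U) fib X (N, q) f \<and> fst X = M \<and> f = g"
    if "N \<in> U" "q \<in> Pr N" "M \<in> U" "g \<in> M \<rightarrow>\<^sub>E N" for N q M g
    using that
    by (intro bexI[of _ "(M, re M g q)"]) (simp_all add: cartesian_fib fib_simps re_closed le_refl)
  then have "fibration (set_cat U) fib"
    by (auto simp: fibration_def functor_fib fib_Obj fib_simps)
  then show ?thesis
    by (simp add: posetal_fibration_def faithful_def fib_simps inj_on_def)
qed

lemma fiber_le_fib:
  assumes "M \<in> U" "p \<in> Pr M" "q \<in> Pr M"
  shows "fiber_le (set_cat U) fib (M, p) (M, q) \<longleftrightarrow> le M p q"
  using assms by (auto simp: fiber_le_def fib_simps re_Id)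

end

text \<open>\<open>a\<close> is the action on predicates that \<open>F\<close> performs over each
  set. \<open>act_re\<close> is a strict form of compatibility with reindexing; for
  \<open>ufam_act\<close> and \<open>fam_act\<close> it is associativity of composition.\<close>

locale indexed_monotone_map =
  A: indexed_preorder U Pr le re + B: indexed_preorder U Pr' le' re'
  for U :: "'u set set" and Pr :: "'u set \<Rightarrow> 'p set" and le re
    and Pr' :: "'u set \<Rightarrow> 'q set" and le' re' +
  fixes F :: "'u set \<times> 'p \<Rightarrow> 'u set \<times> 'q" and a :: "'u set \<Rightarrow> 'p \<Rightarrow> 'q"
  assumes act: "M \<in> U \<Longrightarrow> p \<in> Pr M \<Longrightarrow> F (M, p) = (M, a M p)"
    and act_closed: "M \<in> U \<Longrightarrow> p \<in> Pr M \<Longrightarrow> a M p \<in> Pr' M"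
    and act_mono: "M \<in> U \<Longrightarrow> p \<in> Pr M \<Longrightarrow> q \<in> Pr M \<Longrightarrow> le M p q \<Longrightarrow> le' M (a M p) (a M q)"
    and act_re: "M \<in> U \<Longrightarrow> N \<in> U \<Longrightarrow> g \<in> M \<rightarrow>\<^sub>E N \<Longrightarrow> q \<in> Pr N
      \<Longrightarrow> a M (re M g q) = re' M g (a N q)"
begin

abbreviation map_ftor :: "('u set \<times> 'p, 'u \<Rightarrow> 'u, 'u set \<times> 'q, 'u \<Rightarrow> 'u) ftor" where
  "map_ftor \<equiv> mk_ftor (total A.fib) F (\<lambda>X Y g. g)"

text \<open>The first inequality keeps arrows arrows; both together keep cartesian arrows
  cartesian.\<close>

lemma act_le_re:
  assumes "M \<in> U" "N \<in> U" "g \<in> M \<rightarrow>\<^sub>E N" "p \<in> Pr M" "q \<in> Pr N"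
  shows "le M p (re M g q) \<Longrightarrow> le' M (a M p) (re' M g (a N q))"
    and "le M (re M g q) p \<Longrightarrow> le' M (re' M g (a N q)) (a M p)"
  using act_mono[of M p "re M g q"] act_mono[of M "re M g q" p] assms
  by (simp_all add: act_re A.re_closed)

lemma functor_map: "is_functor (total A.fib) (total B.fib) map_ftor"
  unfolding is_functor_def
  using A.category_fib B.category_fib category_Id[OF A.category_fib]
    category_Comp[OF A.category_fib]
  by (auto simp: A.fib_Obj A.fib_simps B.fib_Obj B.fib_simps act act_closed act_le_re)

lemma fibered_functor_map: "fibered_functor (set_cat U) A.fib B.fib map_ftor"
proof -
  have "cartesian (set_cat U) B.fib (F (M, p)) (F (N, q)) (farr map_ftor (M, p) (N, q) g)"
    if "M \<in> U" "p \<in> Pr M" "N \<in> U" "q \<in> Pr N" "cartesian (set_cat U) A.fib (M, p) (N, q) g"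
    for M p N q g
    using that
    by (simp add: A.cartesian_fib B.cartesian_fib act act_closed act_le_re A.fib_simps)
  then show ?thesis
    by (auto simp: fibered_functor_def functor_map A.fib_Obj A.fib_simps B.fib_simps act)
qed

end

text \<open>The converse viewpoint: an arbitrary fibered functor is read as an action on predicates,
  whose compatibility with reindexing now holds up to equivalence.\<close>

locale indexed_fibered_functor =
  A: indexed_preorder U Pr le re + B: indexed_preorder U Pr' le' re'
  for U :: "'u set set" and Pr :: "'u set \<Rightarrow> 'p set" and le re
    and Pr' :: "'u set \<Rightarrow> 'q set" and le' re' +
  fixes F :: "('u set \<times> 'p, 'u \<Rightarrow> 'u, 'u set \<times> 'q, 'u \<Rightarrow> 'u) ftor"
  assumes fibered: "fibered_functor (set_cat U) A.fib B.fib F"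
begin

definition on_pred :: "'u set \<Rightarrow> 'p \<Rightarrow> 'q" where
  "on_pred M p = snd (fob F (M, p))"

lemma fob_on_pred:
  assumes "M \<in> U" "p \<in> Pr M"
  shows "fob F (M, p) = (M, on_pred M p)"
  using fibered assms
  by (auto simp: fibered_functor_def A.fib_Obj A.fib_simps B.fib_simps on_pred_def prod_eq_iff)

lemma on_pred_closed:
  assumes "M \<in> U" "p \<in> Pr M"
  shows "on_pred M p \<in> Pr' M"
proof -
  have "fob F (M, p) \<in> Obj (total B.fib)"
    using functor_fob[OF fibered_functor_functor[OF fibered]] assms by (simp add: A.fib_simps)
  then show ?thesis
    using assms by (simp add: fob_on_pred B.fib_simps)
qed

text \<open>Both projections return the arrow itself and \<open>F\<close> lies over the identity of
  the base, so \<open>F\<close> cannot change the underlying function.\<close>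

lemma farr_fibered:
  assumes "M \<in> U" "p \<in> Pr M" "N \<in> U" "q \<in> Pr N" "g \<in> M \<rightarrow>\<^sub>E N" "le M p (re M g q)"
  shows "farr F (M, p) (N, q) g = g"
  using fibered assms
  by (auto simp: fibered_functor_def A.fib_Obj A.fib_simps B.fib_simps)

lemma on_pred_mono:
  assumes "M \<in> U" "p \<in> Pr M" "q \<in> Pr M" "le M p q"
  shows "le' M (on_pred M p) (on_pred M q)"
proof -
  have "fiber_le (set_cat U) B.fib (fob F (M, p)) (fob F (M, q))"
    using fiber_le_fob[OF fibered] assms by (simp add: A.fiber_le_fib A.fib_simps)
  then show ?thesis
    using assms by (simp add: fob_on_pred B.fiber_le_fib on_pred_closed)
qed

text \<open>\<open>g\<close> is a cartesian arrow from \<open>(M, re M g q)\<close> to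
  \<open>(N, q)\<close>. Its image under \<open>F\<close> is again cartesian, and
  \<open>cartesian_fib\<close> on the target side reads off both inequalities.\<close>

lemma on_pred_re:
  assumes "M \<in> U" "N \<in> U" "g \<in> M \<rightarrow>\<^sub>E N" "q \<in> Pr N"
  shows "le' M (on_pred M (re M g q)) (re' M g (on_pred N q))"
    and "le' M (re' M g (on_pred N q)) (on_pred M (re M g q))"
proof -
  have re: "re M g q \<in> Pr M"
    using assms by (simp add: A.re_closed)
  have "cartesian (set_cat U) A.fib (M, re M g q) (N, q) g"
    using assms re by (simp add: A.cartesian_fib A.le_refl)
  then have "cartesian (set_cat U) B.fib (fob F (M, re M g q)) (fob F (N, q))
      (farr F (M, re M g q) (N, q) g)"
    using fibered assms re by (simp add: fibered_functor_def A.fib_simps)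
  then have "cartesian (set_cat U) B.fib (M, on_pred M (re M g q)) (N, on_pred N q) g"
    using assms re by (simp add: fob_on_pred farr_fibered A.le_refl)
  then show "le' M (on_pred M (re M g q)) (re' M g (on_pred N q))"
    and "le' M (re' M g (on_pred N q)) (on_pred M (re M g q))"
    using assms re by (simp_all add: B.cartesian_fib on_pred_closed)
qed

end

section \<open>Uniform preorders\<close>

lemma uniform_preorder_car:
  "uniform_preorder U X \<Longrightarrow> i \<in> sorts X \<Longrightarrow> car X i \<in> U"
  by (simp add: uniform_preorder_def)

lemma uniform_preorder_rels:
  "uniform_preorder U X \<Longrightarrow> i \<in> sorts X \<Longrightarrow> j \<in> sorts X \<Longrightarrow> r \<in> rels X i j
    \<Longrightarrow> r \<subseteq> car X i \<times> car X j"
  unfolding uniform_preorder_def by (meson PowD subsetD)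

lemma uniform_preorder_subset:
  "uniform_preorder U X \<Longrightarrow> i \<in> sorts X \<Longrightarrow> j \<in> sorts X \<Longrightarrow> r \<in> rels X i j \<Longrightarrow> s \<subseteq> r
    \<Longrightarrow> s \<in> rels X i j"
  unfolding uniform_preorder_def by metis

lemma uniform_preorder_diagonal:
  "uniform_preorder U X \<Longrightarrow> i \<in> sorts X \<Longrightarrow> \<phi> ` M \<subseteq> car X i
    \<Longrightarrow> {(\<phi> m, \<phi> m) | m. m \<in> M} \<in> rels X i i"
  by (rule uniform_preorder_subset[where r = "Id_on (car X i)"]) (auto simp: uniform_preorder_def)

text \<open>Composition followed by downward closure: the relational composite also relates
  \<open>\<phi> m\<close> to \<open>\<chi> m'\<close> whenever \<open>\<psi> m = \<psi> m'\<close>,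
  so it can be larger than the relation wanted.\<close>

lemma uniform_preorder_trans:
  assumes "uniform_preorder U X" "i \<in> sorts X" "j \<in> sorts X" "k \<in> sorts X"
    and "{(\<phi> m, \<psi> m) | m. m \<in> M} \<in> rels X i j" "{(\<psi> m, \<chi> m) | m. m \<in> M} \<in> rels X j k"
  shows "{(\<phi> m, \<chi> m) | m. m \<in> M} \<in> rels X i k"
proof (rule uniform_preorder_subset[OF assms(1,2,4)])
  show "{(\<phi> m, \<psi> m) | m. m \<in> M} O {(\<psi> m, \<chi> m) | m. m \<in> M} \<in> rels X i k"
    using assms by (simp add: uniform_preorder_def)
qed auto

lemma uord_maps_sorts: "(u, f) \<in> uord_maps X Y \<Longrightarrow> i \<in> sorts X \<Longrightarrow> u i \<in> sorts Y"
  by (auto simp: uord_maps_def)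

lemma uord_maps_car: "(u, f) \<in> uord_maps X Y \<Longrightarrow> i \<in> sorts X \<Longrightarrow> f i \<in> car X i \<rightarrow>\<^sub>E car Y (u i)"
  by (auto simp: uord_maps_def)

lemma uord_maps_app:
  "(u, f) \<in> uord_maps X Y \<Longrightarrow> i \<in> sorts X \<Longrightarrow> a \<in> car X i \<Longrightarrow> f i a \<in> car Y (u i)"
  using uord_maps_car by fastforce

text \<open>Inequalities of predicates and of maps are stated through joint images of two functions;
  this is monotonicity in that parametrized form.\<close>

lemma uord_maps_image:
  assumes "(u, f) \<in> uord_maps X Y" "i \<in> sorts X" "j \<in> sorts X"
    and "{(\<phi> m, \<psi> m) | m. m \<in> M} \<in> rels X i j"
  shows "{(f i (\<phi> m), f j (\<psi> m)) | m. m \<in> M} \<in> rels Y (u i) (u j)"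
proof -
  have "{(f i a, f j b) | a b. (a, b) \<in> {(\<phi> m, \<psi> m) | m. m \<in> M}} \<in> rels Y (u i) (u j)"
    using assms unfolding uord_maps_def by blast
  moreover have "{(f i a, f j b) | a b. (a, b) \<in> {(\<phi> m, \<psi> m) | m. m \<in> M}} =
      {(f i (\<phi> m), f j (\<psi> m)) | m. m \<in> M}"
    by auto
  ultimately show ?thesis by simp
qed

text \<open>The codomain of \<open>f i\<close> depends on \<open>u i\<close>, so the sort maps are
  identified before the families are compared.\<close>

lemma uord_maps_eqI:
  assumes "(u, f) \<in> uord_maps X Y" "(v, g) \<in> uord_maps X Y"
    and "\<And>i. i \<in> sorts X \<Longrightarrow> u i = v i"
    and "\<And>i a. i \<in> sorts X \<Longrightarrow> a \<in> car X i \<Longrightarrow> f i a = g i a"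
  shows "(u, f) = (v, g)"
proof -
  have uv: "u = v"
    using assms by (auto simp: uord_maps_def intro: PiE_ext)
  have "f i = g i" if "i \<in> sorts X" for i
    using uord_maps_car[OF assms(1) that] uord_maps_car[OF assms(2) that] assms(4)[OF that]
    unfolding uv by (rule PiE_ext)
  moreover have "f \<in> extensional (sorts X)" "g \<in> extensional (sorts X)"
    using assms(1,2) by (simp_all add: uord_maps_def PiE_def)
  ultimately have "f = g"
    by (metis extensionalityI)
  then show ?thesis using uv by simp
qed

lemma UOrd_simps:
  "X \<in> Obj (UOrd U) \<longleftrightarrow> uniform_preorder U X"
  "Hom (UOrd U) X Y = uord_maps X Y"
  "Id (UOrd U) X = (\<lambda>i\<in>sorts X. i, \<lambda>i\<in>sorts X. \<lambda>a\<in>car X i. a)"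
  "Comp (UOrd U) X Y Z (v, g) (u, f) =
    (compose (sorts X) v u, \<lambda>i\<in>sorts X. compose (car X i) (g (u i)) (f i))"
  "Le (UOrd U) X Y (u, f) (v, g) \<longleftrightarrow>
    (\<forall>i\<in>sorts X. {(f i a, g i a) | a. a \<in> car X i} \<in> rels Y (u i) (v i))"
  by (simp_all add: UOrd_def)

lemma uord_maps_Id: "(\<lambda>i\<in>sorts X. i, \<lambda>i\<in>sorts X. \<lambda>a\<in>car X i. a) \<in> uord_maps X X"
  if X: "uniform_preorder U X"
proof -
  have "{((\<lambda>a\<in>car X i. a) a, (\<lambda>a\<in>car X j. a) b) | a b. (a, b) \<in> r} = r"
    if "i \<in> sorts X" "j \<in> sorts X" "r \<in> rels X i j" for i j r
    using uniform_preorder_rels[OF X that] by force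
  then show ?thesis
    by (simp add: uord_maps_def)
qed

lemma uord_maps_Comp:
  assumes f: "(u, f) \<in> uord_maps X Y" and g: "(v, g) \<in> uord_maps Y Z" and X: "uniform_preorder U X"
  shows "(compose (sorts X) v u, \<lambda>i\<in>sorts X. compose (car X i) (g (u i)) (f i)) \<in> uord_maps X Z"
proof -
  have "{(compose (car X i) (g (u i)) (f i) a, compose (car X j) (g (u j)) (f j) b) | a b. (a, b) \<in> r}
      \<in> rels Z (v (u i)) (v (u j))"
    if ij: "i \<in> sorts X" "j \<in> sorts X" and r: "r \<in> rels X i j" for i j r
  proof -
    \<comment> \<open>Indexing \<open>r\<close> by its own pairs makes
      \<open>uord_maps_image\<close> applicable, first for \<open>f\<close> and then for
      \<open>g\<close>.\<close>
    have "r = {(fst m, snd m) | m. m \<in> r}"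
      by simp
    then have "{(g (u i) (f i (fst m)), g (u j) (f j (snd m))) | m. m \<in> r} \<in> rels Z (v (u i)) (v (u j))"
      using f g ij r by (intro uord_maps_image[OF g] uord_maps_image[OF f] uord_maps_sorts[OF f]) simp_all
    moreover have "{(compose (car X i) (g (u i)) (f i) a, compose (car X j) (g (u j)) (f j) b)
        | a b. (a, b) \<in> r} = {(g (u i) (f i (fst m)), g (u j) (f j (snd m))) | m. m \<in> r}"
      using uniform_preorder_rels[OF X ij r] by (force simp: compose_def)
    ultimately show ?thesis by simp
  qed
  then show ?thesis
    using uord_maps_sorts[OF f] uord_maps_app[OF f] uord_maps_sorts[OF g] uord_maps_app[OF g]
    by (auto simp: uord_maps_def[of X Z] compose_def)
qed

lemma category_UOrd: "category (UOrd U)"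
proof (rule categoryI)
  fix X assume "X \<in> Obj (UOrd U)"
  then show "Id (UOrd U) X \<in> Hom (UOrd U) X X"
    by (simp add: UOrd_simps uord_maps_Id)
next
  fix X Y Z h k assume "X \<in> Obj (UOrd U)" "h \<in> Hom (UOrd U) X Y" "k \<in> Hom (UOrd U) Y Z"
  then show "Comp (UOrd U) X Y Z k h \<in> Hom (UOrd U) X Z"
    by (cases h; cases k) (simp add: UOrd_simps uord_maps_Comp)
next
  fix X Y h assume "X \<in> Obj (UOrd U)" and h: "h \<in> Hom (UOrd U) X Y"
  then have X: "uniform_preorder U X"
    by (simp add: UOrd_simps)
  obtain u f where uf: "h = (u, f)"
    by fastforce
  with h have f: "(u, f) \<in> uord_maps X Y"
    by (simp add: UOrd_simps)
  show "Comp (UOrd U) X X Y h (Id (UOrd U) X) = h"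
    unfolding uf UOrd_simps using uord_maps_Comp[OF uord_maps_Id[OF X] f X] f
    by (rule uord_maps_eqI) (simp_all add: compose_def)
next
  fix X Y h assume "X \<in> Obj (UOrd U)" "Y \<in> Obj (UOrd U)" and h: "h \<in> Hom (UOrd U) X Y"
  then have X: "uniform_preorder U X" and Y: "uniform_preorder U Y"
    by (simp_all add: UOrd_simps)
  obtain u f where uf: "h = (u, f)"
    by fastforce
  with h have f: "(u, f) \<in> uord_maps X Y"
    by (simp add: UOrd_simps)
  show "Comp (UOrd U) X Y Y (Id (UOrd U) Y) h = h"
    unfolding uf UOrd_simps using uord_maps_Comp[OF f uord_maps_Id[OF Y] X] f
    by (rule uord_maps_eqI)
      (use uord_maps_sorts[OF f] uord_maps_app[OF f] in \<open>simp_all add: compose_def\<close>)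
next
  fix W X Y Z h k l
  assume "W \<in> Obj (UOrd U)" "X \<in> Obj (UOrd U)" "Y \<in> Obj (UOrd U)"
    and h: "h \<in> Hom (UOrd U) W X" and k: "k \<in> Hom (UOrd U) X Y" and l: "l \<in> Hom (UOrd U) Y Z"
  then have W: "uniform_preorder U W" and X: "uniform_preorder U X" and Y: "uniform_preorder U Y"
    by (simp_all add: UOrd_simps)
  obtain u f where uf: "h = (u, f)"
    by fastforce
  obtain v g where vg: "k = (v, g)"
    by fastforce
  obtain w e where we: "l = (w, e)"
    by fastforce
  have f: "(u, f) \<in> uord_maps W X" and g: "(v, g) \<in> uord_maps X Y" and e: "(w, e) \<in> uord_maps Y Z"
    using h k l uf vg we by (simp_all add: UOrd_simps)
  show "Comp (UOrd U) W X Z (Comp (UOrd U) X Y Z l k) h =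
      Comp (UOrd U) W Y Z l (Comp (UOrd U) W X Y k h)"
    unfolding uf vg we UOrd_simps
    using uord_maps_Comp[OF f uord_maps_Comp[OF g e X] W] uord_maps_Comp[OF uord_maps_Comp[OF f g W] e W]
    by (rule uord_maps_eqI)
      (use uord_maps_sorts[OF f] uord_maps_app[OF f] in \<open>simp_all add: compose_def\<close>)
qed

lemma lpcategory_UOrd: "lpcategory (UOrd U)"
proof (rule lpcategoryI[OF category_UOrd])
  fix X Y h assume XY: "X \<in> Obj (UOrd U)" "Y \<in> Obj (UOrd U)" and "h \<in> Hom (UOrd U) X Y"
  moreover obtain u f where uf: "h = (u, f)"
    by fastforce
  ultimately have f: "(u, f) \<in> uord_maps X Y" and Y: "uniform_preorder U Y"
    by (simp_all add: UOrd_simps)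
  have "{(f i a, f i a) | a. a \<in> car X i} \<in> rels Y (u i) (u i)" if "i \<in> sorts X" for i
    using uord_maps_car[OF f that] by (intro uniform_preorder_diagonal[OF Y uord_maps_sorts[OF f that]]) auto
  then show "Le (UOrd U) X Y h h"
    by (simp add: uf UOrd_simps)
next
  fix X Y h k l
  assume XY: "X \<in> Obj (UOrd U)" "Y \<in> Obj (UOrd U)"
    and h: "h \<in> Hom (UOrd U) X Y" and k: "k \<in> Hom (UOrd U) X Y" and l: "l \<in> Hom (UOrd U) X Y"
    and le: "Le (UOrd U) X Y h k" "Le (UOrd U) X Y k l"
  obtain u f where uf: "h = (u, f)"
    by fastforce
  obtain v g where vg: "k = (v, g)"
    by fastforce
  obtain w e where we: "l = (w, e)"
    by fastforce
  have Y: "uniform_preorder U Y"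
    and f: "(u, f) \<in> uord_maps X Y" and g: "(v, g) \<in> uord_maps X Y" and e: "(w, e) \<in> uord_maps X Y"
    using XY h k l uf vg we by (simp_all add: UOrd_simps)
  have "{(f i a, e i a) | a. a \<in> car X i} \<in> rels Y (u i) (w i)" if "i \<in> sorts X" for i
    using le that unfolding uf vg we UOrd_simps
    by (intro uniform_preorder_trans[where \<psi> = "g i", OF Y uord_maps_sorts[OF f that] uord_maps_sorts[OF g that]
        uord_maps_sorts[OF e that]]) simp_all
  then show "Le (UOrd U) X Y h l"
    by (simp add: uf we UOrd_simps)
next
  fix X Y Z h h' k k'
  assume ob: "X \<in> Obj (UOrd U)" "Y \<in> Obj (UOrd U)" "Z \<in> Obj (UOrd U)"
    and h: "h \<in> Hom (UOrd U) X Y" "h' \<in> Hom (UOrd U) X Y"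
    and k: "k \<in> Hom (UOrd U) Y Z" "k' \<in> Hom (UOrd U) Y Z"
    and le: "Le (UOrd U) X Y h h'" "Le (UOrd U) Y Z k k'"
  obtain u f u' f' where uf: "h = (u, f)" "h' = (u', f')"
    by fastforce
  obtain v g v' g' where vg: "k = (v, g)" "k' = (v', g')"
    by fastforce
  have Z: "uniform_preorder U Z"
    and f: "(u, f) \<in> uord_maps X Y" and f': "(u', f') \<in> uord_maps X Y"
    and g: "(v, g) \<in> uord_maps Y Z" and g': "(v', g') \<in> uord_maps Y Z"
    using ob h k uf vg by (simp_all add: UOrd_simps)
  \<comment> \<open>Interchange through \<open>g (u' i) (f' i a)\<close>: monotonicity of
    \<open>(v, g)\<close> applied to the first 2-cell, then the second 2-cell at the sort
    \<open>u' i\<close>, restricted to the values of \<open>f' i\<close>.\<close>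
  have "{(g (u i) (f i a), g' (u' i) (f' i a)) | a. a \<in> car X i} \<in> rels Z (v (u i)) (v' (u' i))"
    if i: "i \<in> sorts X" for i
  proof (rule uniform_preorder_trans[OF Z])
    note ui = uord_maps_sorts[OF f i] and ui' = uord_maps_sorts[OF f' i]
    show "v (u i) \<in> sorts Z" "v (u' i) \<in> sorts Z" "v' (u' i) \<in> sorts Z"
      using ui ui' by (simp_all add: uord_maps_sorts[OF g] uord_maps_sorts[OF g'])
    show "{(g (u i) (f i a), g (u' i) (f' i a)) | a. a \<in> car X i} \<in> rels Z (v (u i)) (v (u' i))"
      using le(1) i by (intro uord_maps_image[OF g ui ui']) (simp add: uf UOrd_simps)
    show "{(g (u' i) (f' i a), g' (u' i) (f' i a)) | a. a \<in> car X i} \<in> rels Z (v (u' i)) (v' (u' i))"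
    proof (rule uniform_preorder_subset[OF Z])
      show "{(g (u' i) b, g' (u' i) b) | b. b \<in> car Y (u' i)} \<in> rels Z (v (u' i)) (v' (u' i))"
        using le(2) ui' by (simp add: vg UOrd_simps)
    qed (use uord_maps_car[OF f' i] ui' uord_maps_sorts[OF g] uord_maps_sorts[OF g'] in auto)
  qed
  moreover have "{(compose (car X i) (g (u i)) (f i) a, compose (car X i) (g' (u' i)) (f' i) a)
      | a. a \<in> car X i} = {(g (u i) (f i a), g' (u' i) (f' i a)) | a. a \<in> car X i}" for i
    by (rule Collect_cong, rule ex_cong1) (auto simp: compose_eq)
  ultimately show "Le (UOrd U) X Z (Comp (UOrd U) X Y Z k h) (Comp (UOrd U) X Y Z k' h')"
    by (simp add: uf vg UOrd_simps compose_eq)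
qed

section \<open>Preorders\<close>

lemma Ord_simps:
  "D \<in> Obj (Ord U) \<longleftrightarrow> fst D \<in> U \<and> preorder_on (fst D) (snd D)"
  "f \<in> Hom (Ord U) D E \<longleftrightarrow> f \<in> fst D \<rightarrow>\<^sub>E fst E \<and> (\<forall>x y. (x, y) \<in> snd D \<longrightarrow> (f x, f y) \<in> snd E)"
  "Id (Ord U) D = (\<lambda>x\<in>fst D. x)"
  "Comp (Ord U) D E H g f = compose (fst D) g f"
  "Le (Ord U) D E f g \<longleftrightarrow> (\<forall>x\<in>fst D. (f x, g x) \<in> snd E)"
  by (auto simp: Ord_def split: prod.splits)

lemma lpcategory_Ord: "lpcategory (Ord U)"
proof (rule lpcategoryI)
  show "category (Ord U)"
  proof (rule categoryI)
    fix D E H f g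
    assume "D \<in> Obj (Ord U)" "f \<in> Hom (Ord U) D E" "g \<in> Hom (Ord U) E H"
    moreover from this have "x \<in> fst D" "y \<in> fst D" if "(x, y) \<in> snd D" for x y
      using that by (auto simp: Ord_simps preorder_on_def)
    ultimately show "Comp (Ord U) D E H g f \<in> Hom (Ord U) D H"
      by (auto simp: Ord_simps compose_eq del: PiE_I intro: compose_PiE)
  qed (auto simp: Ord_simps compose_Id_PiE compose_assoc_PiE preorder_on_def)
next
  fix D E f
  assume "E \<in> Obj (Ord U)" "f \<in> Hom (Ord U) D E"
  then show "Le (Ord U) D E f f"
    by (auto simp: Ord_simps preorder_on_def refl_on_def PiE_mem)
next
  fix D E f g h
  assume "E \<in> Obj (Ord U)" "Le (Ord U) D E f g" "Le (Ord U) D E g h"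
  then show "Le (Ord U) D E f h"
    unfolding Ord_simps preorder_on_def by (metis transD)
next
  fix D E H f f' g g'
  assume H: "H \<in> Obj (Ord U)" and f': "f' \<in> Hom (Ord U) D E" and g: "g \<in> Hom (Ord U) E H"
    and le: "Le (Ord U) D E f f'" "Le (Ord U) E H g g'"
  have "(g (f x), g' (f' x)) \<in> snd H" if x: "x \<in> fst D" for x
  proof (rule transD)
    show "trans (snd H)"
      using H by (simp add: Ord_simps preorder_on_def)
    show "(g (f x), g (f' x)) \<in> snd H"
      using le(1) g x by (auto simp: Ord_simps)
    show "(g (f' x), g' (f' x)) \<in> snd H"
      using le(2) f' x by (auto simp: Ord_simps)
  qed
  then show "Le (Ord U) D H (Comp (Ord U) D E H g f) (Comp (Ord U) D E H g' f')"
    by (simp add: Ord_simps compose_eq)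
qed

text \<open>Makes the sort set of \<open>one_sorted\<close> small: a singleton is the image of a
  nonempty member of \<open>U\<close> under a constant function.\<close>

lemma singleton_universe:
  assumes "set_universe U"
  shows "{x} \<in> U"
proof -
  obtain M where M: "M \<in> U" "M \<noteq> {}"
    using assms by (auto simp: set_universe_def)
  then have "(\<lambda>_. x) ` M \<in> U"
    using assms unfolding set_universe_def by blast
  moreover have "(\<lambda>_. x) ` M = {x}"
    using M(2) by auto
  ultimately show ?thesis by simp
qed

lemma one_sorted_simps [simp]:
  "sorts (one_sorted D) = {undefined}"
  "car (one_sorted D) i = fst D"
  "rels (one_sorted D) i j = Pow (snd D)"
  by (simp_all add: one_sorted_def split_beta)

text \<open>The relations form a principal ideal, so the axioms concern only its top
  \<open>snd D\<close>: reflexivity puts the diagonal below it, transitivity its composite with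
  itself.\<close>

lemma uniform_preorder_one_sorted:
  assumes "set_universe U" "fst D \<in> U" "preorder_on (fst D) (snd D)"
  shows "uniform_preorder U (one_sorted D)"
  using assms singleton_universe[OF assms(1)]
  by (auto simp: uniform_preorder_def preorder_on_def refl_on_def dest: transD; blast dest: transD)

text \<open>The hom-preorders are even isomorphic: a map between one-sorted objects has only one
  possible action on sorts, and its single component is an order-preserving function.\<close>

lemma local_equivalence_ord_to_uord:
  assumes U: "set_universe U"
  shows "local_equivalence (Ord U) (UOrd U) ord_to_uord"
proof -
  let ?h = "\<lambda>f :: 'a \<Rightarrow> 'a. (\<lambda>i\<in>{undefined :: 'a}. i, \<lambda>i\<in>{undefined :: 'a}. f)"
  have ord: "fob ord_to_uord D = one_sorted D" "farr ord_to_uord D E f = ?h f"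
    for D E :: "'a set \<times> ('a \<times> 'a) set" and f
    by (simp_all add: ord_to_uord_def)
  have Le: "Le (UOrd U) (one_sorted D) (one_sorted E) (?h f) (?h g) \<longleftrightarrow> Le (Ord U) D E f g"
    for D E f g
    by (auto simp: UOrd_simps Ord_simps)
  have Hom: "?h f \<in> Hom (UOrd U) (one_sorted D) (one_sorted E)" if "f \<in> Hom (Ord U) D E" for D E f
    using that by (auto simp: UOrd_simps Ord_simps uord_maps_def)
  have "is_functor (Ord U) (UOrd U) ord_to_uord"
    unfolding is_functor_def
    by (auto simp: ord Hom lpcategory_category lpcategory_Ord category_UOrd)
      (auto simp: UOrd_simps Ord_simps uniform_preorder_one_sorted U compose_def)
  then have two: "two_functor (Ord U) (UOrd U) ord_to_uord"
    by (simp add: two_functor_def lpcategory_Ord lpcategory_UOrd ord Le)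
  have "\<exists>f\<in>Hom (Ord U) D E. ?h f = k"
    if D: "D \<in> Obj (Ord U)" and k: "k \<in> Hom (UOrd U) (one_sorted D) (one_sorted E)" for D E k
  proof -
    obtain u f where uf: "k = (u, f)" and f: "(u, f) \<in> uord_maps (one_sorted D) (one_sorted E)"
      using k by (cases k) (simp add: UOrd_simps)
    have "f undefined \<in> fst D \<rightarrow>\<^sub>E fst E"
      using uord_maps_car[OF f] by simp
    \<comment> \<open>Monotonicity is tested on the largest relation \<open>snd D\<close>.\<close>
    moreover have "{(f undefined a, f undefined b) | a b. (a, b) \<in> snd D} \<subseteq> snd E"
      using f by (auto simp: uord_maps_def)
    ultimately have Hf: "f undefined \<in> Hom (Ord U) D E"
      by (auto simp: Ord_simps)
    have "?h (f undefined) = (u, f)"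
      using Hom[OF Hf] f uord_maps_sorts[OF f] unfolding UOrd_simps
      by (intro uord_maps_eqI) auto
    then show ?thesis
      using Hf uf by blast
  qed
  then have "\<exists>f\<in>Hom (Ord U) D E.
      Le (UOrd U) (one_sorted D) (one_sorted E) (?h f) k \<and>
      Le (UOrd U) (one_sorted D) (one_sorted E) k (?h f)"
    if "D \<in> Obj (Ord U)" "E \<in> Obj (Ord U)"
      "k \<in> Hom (UOrd U) (one_sorted D) (one_sorted E)" for D E k
    using that functor_fob[OF two_functor_functor[OF two]] lpcategory_UOrd[of U]
    unfolding lpcategory_def ord by metis
  then show ?thesis
    unfolding local_equivalence_def using two by (simp add: ord Le)
qed

section \<open>The family constructions\<close>

lemma SPred_in_ufam_preds [simp]:
  "SPred i \<phi> \<in> ufam_preds X M \<longleftrightarrow> i \<in> sorts X \<and> \<phi> \<in> M \<rightarrow>\<^sub>E car X i"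
  by (auto simp: ufam_preds_def)

lemma ufam_predsE:
  assumes "p \<in> ufam_preds X M"
  obtains i \<phi> where "p = SPred i \<phi>" "i \<in> sorts X" "\<phi> \<in> M \<rightarrow>\<^sub>E car X i"
  using assms by (auto simp: ufam_preds_def)

lemma ball_ufam_preds:
  "(\<forall>p\<in>ufam_preds X M. P p) \<longleftrightarrow> (\<forall>i\<in>sorts X. \<forall>\<phi>\<in>M \<rightarrow>\<^sub>E car X i. P (SPred i \<phi>))"
  unfolding ufam_preds_def by blast

lemma FPred_in_fam_preds [simp]: "FPred \<phi> \<in> fam_preds D M \<longleftrightarrow> \<phi> \<in> M \<rightarrow>\<^sub>E fst D"
  by (auto simp: fam_preds_def)

lemma fam_predsE:
  assumes "p \<in> fam_preds D M"
  obtains \<phi> where "p = FPred \<phi>" "\<phi> \<in> M \<rightarrow>\<^sub>E fst D"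
  using assms by (auto simp: fam_preds_def)

text \<open>The axioms of a uniform preorder in fibrational terms: identities and composition, each
  with downward closure, give reflexivity and transitivity, and downward closure alone gives
  monotonicity of reindexing, since precomposition shrinks joint images.\<close>

lemma indexed_preorder_ufam:
  assumes X: "uniform_preorder U X"
  shows "indexed_preorder U (ufam_preds X) (ufam_le X) precomp"
proof
  fix M p assume "p \<in> ufam_preds X M"
  then show "ufam_le X M p p"
    by (elim ufam_predsE) (auto intro!: uniform_preorder_diagonal[OF X])
next
  fix M p q r
  assume "p \<in> ufam_preds X M" "q \<in> ufam_preds X M" "r \<in> ufam_preds X M"
    and "ufam_le X M p q" "ufam_le X M q r"
  then show "ufam_le X M p r"
    by (elim ufam_predsE) (simp, rule uniform_preorder_trans[OF X]; assumption)
next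
  fix M N :: "'a set" and g p q
  assume g: "g \<in> M \<rightarrow>\<^sub>E N" and p: "p \<in> ufam_preds X N" and q: "q \<in> ufam_preds X N"
    and le: "ufam_le X N p q"
  obtain i \<phi> where i: "p = SPred i \<phi>" "i \<in> sorts X"
    using p by (rule ufam_predsE)
  obtain j \<psi> where j: "q = SPred j \<psi>" "j \<in> sorts X"
    using q by (rule ufam_predsE)
  have "{(compose M \<phi> g m, compose M \<psi> g m) | m. m \<in> M} \<in> rels X i j"
  proof (rule uniform_preorder_subset[OF X i(2) j(2)])
    show "{(\<phi> n, \<psi> n) | n. n \<in> N} \<in> rels X i j"
      using le i j by simp
    show "{(compose M \<phi> g m, compose M \<psi> g m) | m. m \<in> M} \<subseteq> {(\<phi> n, \<psi> n) | n. n \<in> N}"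
      using g by (auto simp: compose_eq)
  qed
  then show "ufam_le X M (precomp M g p) (precomp M g q)"
    using i j by simp
next
  fix M N :: "'a set" and g q assume "g \<in> M \<rightarrow>\<^sub>E N" "q \<in> ufam_preds X N"
  then show "precomp M g q \<in> ufam_preds X M"
    by (elim ufam_predsE) (simp add: compose_PiE[of g M N])
qed (auto elim!: ufam_predsE simp: compose_Id_PiE compose_assoc_PiE)

lemma indexed_preorder_fam:
  assumes D: "preorder_on (fst D) (snd D)"
  shows "indexed_preorder U (fam_preds D) (fam_le D) precomp"
proof
  fix M p assume "p \<in> fam_preds D M"
  then show "fam_le D M p p"
    using D by (elim fam_predsE) (auto simp: preorder_on_def refl_on_def PiE_mem)
next
  fix M p q r
  assume "p \<in> fam_preds D M" "q \<in> fam_preds D M" "r \<in> fam_preds D M"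
    and "fam_le D M p q" "fam_le D M q r"
  then show "fam_le D M p r"
    using D by (elim fam_predsE) (simp add: preorder_on_def, metis transD)
next
  fix M N :: "'a set" and g p q
  assume "g \<in> M \<rightarrow>\<^sub>E N" "p \<in> fam_preds D N" "q \<in> fam_preds D N" "fam_le D N p q"
  then show "fam_le D M (precomp M g p) (precomp M g q)"
    by (elim fam_predsE) (auto simp: compose_eq)
next
  fix M N :: "'a set" and g q assume "g \<in> M \<rightarrow>\<^sub>E N" "q \<in> fam_preds D N"
  then show "precomp M g q \<in> fam_preds D M"
    by (elim fam_predsE) (simp add: compose_PiE[of g M N])
qed (auto elim!: fam_predsE simp: compose_Id_PiE compose_assoc_PiE compose_eq PiE_mem)

lemma indexed_monotone_map_ufam:
  assumes X: "uniform_preorder U X" and Y: "uniform_preorder U Y" and f: "(u, f) \<in> uord_maps X Y"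
  shows "indexed_monotone_map U (ufam_preds X) (ufam_le X) precomp (ufam_preds Y) (ufam_le Y) precomp
    (ufam_act (u, f)) (\<lambda>M p. snd (ufam_act (u, f) (M, p)))"
proof -
  interpret A: indexed_preorder U "ufam_preds X" "ufam_le X" precomp
    using X by (rule indexed_preorder_ufam)
  interpret B: indexed_preorder U "ufam_preds Y" "ufam_le Y" precomp
    using Y by (rule indexed_preorder_ufam)
  \<comment> \<open>Strips the restriction built into \<open>compose\<close>; the index runs over
    \<open>M\<close> only.\<close>
  have eq: "{(compose M f \<phi> m, compose M g \<psi> m) | m. m \<in> M} = {(f (\<phi> m), g (\<psi> m)) | m. m \<in> M}"
    for M :: "'a set" and f g \<phi> \<psi> :: "'a \<Rightarrow> 'a"
    by (rule Collect_cong, rule ex_cong1) (auto simp: compose_eq)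
  show ?thesis
  proof
    fix M p q
    assume "p \<in> ufam_preds X M" "q \<in> ufam_preds X M" and "ufam_le X M p q"
    then show "ufam_le Y M (snd (ufam_act (u, f) (M, p))) (snd (ufam_act (u, f) (M, q)))"
      by (elim ufam_predsE) (simp add: eq uord_maps_image[OF f])
  next
    fix M N :: "'a set" and g q
    assume "g \<in> M \<rightarrow>\<^sub>E N" "q \<in> ufam_preds X N"
    then show "snd (ufam_act (u, f) (M, precomp M g q)) =
        precomp M g (snd (ufam_act (u, f) (N, q)))"
      by (elim ufam_predsE) (simp add: compose_assoc_PiE)
  next
    fix M p assume "p \<in> ufam_preds X M"
    then show "snd (ufam_act (u, f) (M, p)) \<in> ufam_preds Y M"
      using uord_maps_sorts[OF f] uord_maps_car[OF f]
      by (elim ufam_predsE) (auto intro: compose_PiE del: PiE_I)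
  qed (auto elim!: ufam_predsE)
qed

lemma indexed_monotone_map_fam:
  assumes D: "preorder_on (fst D) (snd D)" and E: "preorder_on (fst E) (snd E)"
    and f: "f \<in> Hom (Ord U) D E"
  shows "indexed_monotone_map U (fam_preds D) (fam_le D) precomp (fam_preds E) (fam_le E) precomp
    (fam_act f) (\<lambda>M p. snd (fam_act f (M, p)))"
proof -
  interpret A: indexed_preorder U "fam_preds D" "fam_le D" precomp
    using D by (rule indexed_preorder_fam)
  interpret B: indexed_preorder U "fam_preds E" "fam_le E" precomp
    using E by (rule indexed_preorder_fam)
  show ?thesis
  proof
    fix M p q
    assume "p \<in> fam_preds D M" "q \<in> fam_preds D M" and "fam_le D M p q"
    then show "fam_le E M (snd (fam_act f (M, p))) (snd (fam_act f (M, q)))"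
      using f by (elim fam_predsE) (simp add: Ord_simps compose_eq)
  next
    fix M N :: "'a set" and g q
    assume "g \<in> M \<rightarrow>\<^sub>E N" "q \<in> fam_preds D N"
    then show "snd (fam_act f (M, precomp M g q)) = precomp M g (snd (fam_act f (N, q)))"
      by (elim fam_predsE) (simp add: compose_assoc_PiE)
  next
    fix M p assume "p \<in> fam_preds D M"
    then show "snd (fam_act f (M, p)) \<in> fam_preds E M"
      using f by (elim fam_predsE) (auto simp: Ord_simps intro: compose_PiE del: PiE_I)
  qed (auto elim!: fam_predsE)
qed

section \<open>The 2-functor \<open>ufam\<close> and its local equivalence\<close>

lemma ufam_simps:
  "fob (ufam U) X = fib_of_preds U (ufam_preds X) (ufam_le X) precomp"
  "farr (ufam U) X Y h =
    mk_ftor (total (fib_of_preds U (ufam_preds X) (ufam_le X) precomp)) (ufam_act h) (\<lambda>p q g. g)"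
  by (simp_all add: ufam_def ufam_ob_def)

lemma fam_simps:
  "fob (fam U) D = fib_of_preds U (fam_preds D) (fam_le D) precomp"
  "farr (fam U) D E h =
    mk_ftor (total (fib_of_preds U (fam_preds D) (fam_le D) precomp)) (fam_act h) (\<lambda>p q g. g)"
  by (simp_all add: fam_def fam_ob_def)

lemma Le_fob_fib_of_preds:
  assumes P: "indexed_preorder U Pr le re" and F: "indexed_monotone_map U Pr le re Pr' le' re' F a"
    and G: "indexed_monotone_map U Pr le re Pr' le' re' G b"
  shows "Le (PFib (set_cat U)) (fib_of_preds U Pr le re) (fib_of_preds U Pr' le' re')
      (mk_ftor (total (fib_of_preds U Pr le re)) F (\<lambda>p q g. g))
      (mk_ftor (total (fib_of_preds U Pr le re)) G (\<lambda>p q g. g)) \<longleftrightarrow>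
    (\<forall>M\<in>U. \<forall>p\<in>Pr M. le' M (a M p) (b M p))"
proof -
  interpret F: indexed_monotone_map U Pr le re Pr' le' re' F a
    by (rule F)
  interpret G: indexed_monotone_map U Pr le re Pr' le' re' G b
    by (rule G)
  show ?thesis
    by (auto simp: PFib_simps F.A.fib_Obj F.A.fib_simps F.act G.act F.B.fiber_le_fib
        F.act_closed G.act_closed)
qed

lemma ufam_Id:
  assumes X: "uniform_preorder U X"
  shows "farr (ufam U) X X (Id (UOrd U) X) = id_ftor (total (fob (ufam U) X))"
proof -
  interpret indexed_preorder U "ufam_preds X" "ufam_le X" precomp
    using X by (rule indexed_preorder_ufam)
  show ?thesis
    unfolding ufam_simps UOrd_simps id_ftor_def
    by (rule mk_ftor_cong) (auto simp: fib_Obj elim!: ufam_predsE simp: compose_Id_PiE)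
qed

lemma ufam_Comp:
  assumes X: "uniform_preorder U X" and Y: "uniform_preorder U Y"
    and h: "h \<in> uord_maps X Y" and k: "k \<in> uord_maps Y Z"
  shows "farr (ufam U) X Z (Comp (UOrd U) X Y Z k h) =
    comp_ftor (total (fob (ufam U) X)) (farr (ufam U) Y Z k) (farr (ufam U) X Y h)"
proof -
  obtain u f v g where uf: "h = (u, f)" and vg: "k = (v, g)"
    by (cases h, cases k)
  have f: "(u, f) \<in> uord_maps X Y" and g: "(v, g) \<in> uord_maps Y Z"
    using h k uf vg by simp_all
  interpret indexed_monotone_map U "ufam_preds X" "ufam_le X" precomp "ufam_preds Y" "ufam_le Y"
      precomp "ufam_act (u, f)" "\<lambda>M p. snd (ufam_act (u, f) (M, p))"
    using X Y f by (rule indexed_monotone_map_ufam)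
  show ?thesis
    unfolding ufam_simps uf vg UOrd_simps comp_mk_ftor[OF functor_map]
    by (rule mk_ftor_cong)
      (use uord_maps_sorts[OF f] in \<open>auto simp: A.fib_Obj elim!: ufam_predsE
        simp: compose_eq compose_assoc_PiE\<close>)
qed

text \<open>Being an equivalence, it yields both the action of \<open>ufam\<close> on 2-cells and
  the reflection of the order.\<close>

lemma Le_ufam:
  assumes X: "uniform_preorder U X" and Y: "uniform_preorder U Y"
    and h: "h \<in> uord_maps X Y" and k: "k \<in> uord_maps X Y"
  shows "Le (PFib (set_cat U)) (fob (ufam U) X) (fob (ufam U) Y)
      (farr (ufam U) X Y h) (farr (ufam U) X Y k) \<longleftrightarrow> Le (UOrd U) X Y h k"
proof -
  obtain u f v g where uf: "h = (u, f)" and vg: "k = (v, g)"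
    by (cases h, cases k)
  have f: "(u, f) \<in> uord_maps X Y" and g: "(v, g) \<in> uord_maps X Y"
    using h k uf vg by simp_all
  have eq: "{(compose M a \<phi> m, compose M b \<phi> m) | m. m \<in> M} = {(a (\<phi> m), b (\<phi> m)) | m. m \<in> M}"
    for M :: "'a set" and a b \<phi> :: "'a \<Rightarrow> 'a"
    by (rule Collect_cong, rule ex_cong1) (auto simp: compose_eq)
  have "Le (PFib (set_cat U)) (fob (ufam U) X) (fob (ufam U) Y)
      (farr (ufam U) X Y h) (farr (ufam U) X Y k) \<longleftrightarrow>
    (\<forall>M\<in>U. \<forall>p\<in>ufam_preds X M.
      ufam_le Y M (snd (ufam_act (u, f) (M, p))) (snd (ufam_act (v, g) (M, p))))"
    unfolding ufam_simps uf vg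
    by (rule Le_fob_fib_of_preds[OF indexed_preorder_ufam[OF X]
        indexed_monotone_map_ufam[OF X Y f] indexed_monotone_map_ufam[OF X Y g]])
  also have "\<dots> \<longleftrightarrow> (\<forall>M\<in>U. \<forall>i\<in>sorts X. \<forall>\<phi>\<in>M \<rightarrow>\<^sub>E car X i.
      {(f i (\<phi> m), g i (\<phi> m)) | m. m \<in> M} \<in> rels Y (u i) (v i))"
    by (simp add: ball_ufam_preds eq)
  also have "\<dots> \<longleftrightarrow> (\<forall>i\<in>sorts X. {(f i a, g i a) | a. a \<in> car X i} \<in> rels Y (u i) (v i))"
  proof (intro iffI ballI)
    fix i assume i: "i \<in> sorts X"
      and le: "\<forall>M\<in>U. \<forall>i\<in>sorts X. \<forall>\<phi>\<in>M \<rightarrow>\<^sub>E car X i.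
        {(f i (\<phi> m), g i (\<phi> m)) | m. m \<in> M} \<in> rels Y (u i) (v i)"
    \<comment> \<open>The instance at the generic predicate of sort \<open>i\<close>, available
      because \<open>car X i\<close> itself belongs to \<open>U\<close>.\<close>
    have "{(f i ((\<lambda>a\<in>car X i. a) a), g i ((\<lambda>a\<in>car X i. a) a)) | a. a \<in> car X i}
        \<in> rels Y (u i) (v i)"
      using uniform_preorder_car[OF X i] i by (intro le[rule_format]) auto
    moreover have "{(f i ((\<lambda>a\<in>car X i. a) a), g i ((\<lambda>a\<in>car X i. a) a)) | a. a \<in> car X i} =
        {(f i a, g i a) | a. a \<in> car X i}"
      by (rule Collect_cong, rule ex_cong1) auto
    ultimately show "{(f i a, g i a) | a. a \<in> car X i} \<in> rels Y (u i) (v i)"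
      by simp
  next
    fix M i \<phi> assume i: "i \<in> sorts X" and \<phi>: "\<phi> \<in> M \<rightarrow>\<^sub>E car X i"
      and le: "\<forall>i\<in>sorts X. {(f i a, g i a) | a. a \<in> car X i} \<in> rels Y (u i) (v i)"
    \<comment> \<open>The pairs indexed by \<open>M\<close> are among those indexed by the
      carrier.\<close>
    show "{(f i (\<phi> m), g i (\<phi> m)) | m. m \<in> M} \<in> rels Y (u i) (v i)"
      using le i \<phi>
      by (intro uniform_preorder_subset[OF Y uord_maps_sorts[OF f i] uord_maps_sorts[OF g i]
            le[rule_format, OF i]]) auto
  qed
  finally show ?thesis
    by (simp add: uf vg UOrd_simps)
qed

lemma two_functor_ufam: "two_functor (UOrd U) (PFib (set_cat U)) (ufam U)"
proof -
  have ob: "fob (ufam U) X \<in> Obj (PFib (set_cat U))" if X: "uniform_preorder U X" for X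
  proof -
    interpret indexed_preorder U "ufam_preds X" "ufam_le X" precomp
      using X by (rule indexed_preorder_ufam)
    show ?thesis
      by (simp add: PFib_simps ufam_simps posetal_fibration_fib)
  qed
  have ar: "farr (ufam U) X Y h \<in> Hom (PFib (set_cat U)) (fob (ufam U) X) (fob (ufam U) Y)"
    if "uniform_preorder U X" "uniform_preorder U Y" "h \<in> uord_maps X Y" for X Y h
  proof -
    interpret indexed_monotone_map U "ufam_preds X" "ufam_le X" precomp "ufam_preds Y" "ufam_le Y"
        precomp "ufam_act (fst h, snd h)" "\<lambda>M p. snd (ufam_act (fst h, snd h) (M, p))"
      by (rule indexed_monotone_map_ufam) (use that in simp_all)
    show ?thesis
      using fibered_functor_map by (simp add: PFib_simps ufam_simps)
  qed
  have "is_functor (UOrd U) (PFib (set_cat U)) (ufam U)"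
    unfolding is_functor_def
    using lpcategory_category[OF lpcategory_PFib] category_UOrd ob ar ufam_Id ufam_Comp
    by (auto simp: UOrd_simps(1,2) PFib_simps(3,4))
  then show ?thesis
    by (auto simp: two_functor_def lpcategory_UOrd lpcategory_PFib UOrd_simps(1,2) Le_ufam)
qed

text \<open>Predicates live on sets of elements of \<open>'u\<close>, whereas \<open>r\<close>
  consists of pairs. The universe supplies an injection \<open>e\<close> coding pairs; the image of
  \<open>r\<close> is small as a subset of the coded product, and the legs are the projections after
  decoding by \<open>d\<close>.\<close>

lemma relation_span:
  assumes U: "set_universe U" and A: "A \<in> U" and B: "B \<in> U" and r: "r \<subseteq> A \<times> B"
  obtains M \<pi> \<rho> where "M \<in> U" "\<pi> \<in> M \<rightarrow>\<^sub>E A" "\<rho> \<in> M \<rightarrow>\<^sub>E B" "r = {(\<pi> m, \<rho> m) | m. m \<in> M}"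
proof -
  obtain e where e: "inj_on e (A \<times> B)" "e ` (A \<times> B) \<in> U"
    using U A B unfolding set_universe_def by meson
  define d where "d = inv_into (A \<times> B) e"
  have d: "d (e x) = x" if "x \<in> r" for x
    unfolding d_def using inv_into_f_f[OF e(1)] r that by auto
  show ?thesis
  proof
    show "e ` r \<in> U"
      using U e(2) r unfolding set_universe_def by (meson image_mono)
    show "(\<lambda>m\<in>e ` r. fst (d m)) \<in> e ` r \<rightarrow>\<^sub>E A" "(\<lambda>m\<in>e ` r. snd (d m)) \<in> e ` r \<rightarrow>\<^sub>E B"
      using r by (auto simp: d)
    have "{((\<lambda>m\<in>e ` r. fst (d m)) m, (\<lambda>m\<in>e ` r. snd (d m)) m) | m. m \<in> e ` r} = d ` e ` r"
      by (auto simp: image_iff)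
    also have "\<dots> = r"
      using d by (force simp: image_image)
    finally show "r = {((\<lambda>m\<in>e ` r. fst (d m)) m, (\<lambda>m\<in>e ` r. snd (d m)) m) | m. m \<in> e ` r}"
      by (rule sym)
  qed
qed

lemma local_equivalence_ufam:
  assumes U: "set_universe U"
  shows "local_equivalence (UOrd U) (PFib (set_cat U)) (ufam U)"
proof -
  have surj: "\<exists>h\<in>uord_maps X Y.
      Le (PFib (set_cat U)) (fob (ufam U) X) (fob (ufam U) Y) (farr (ufam U) X Y h) F \<and>
      Le (PFib (set_cat U)) (fob (ufam U) X) (fob (ufam U) Y) F (farr (ufam U) X Y h)"
    if X: "uniform_preorder U X" and Y: "uniform_preorder U Y"
      and F: "F \<in> Hom (PFib (set_cat U)) (fob (ufam U) X) (fob (ufam U) Y)" for X Y F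
  proof -
    interpret A: indexed_preorder U "ufam_preds X" "ufam_le X" precomp
      using X by (rule indexed_preorder_ufam)
    interpret B: indexed_preorder U "ufam_preds Y" "ufam_le Y" precomp
      using Y by (rule indexed_preorder_ufam)
    interpret indexed_fibered_functor U "ufam_preds X" "ufam_le X" precomp "ufam_preds Y"
        "ufam_le Y" precomp F
      using F by unfold_locales (simp add: ufam_simps PFib_simps)
    let ?gen = "\<lambda>i. SPred i (\<lambda>a\<in>car X i. a)"
    have gen: "?gen i \<in> ufam_preds X (car X i)" if "i \<in> sorts X" for i
      using that by auto
    have "\<exists>u f. on_pred (car X i) (?gen i) = SPred u f \<and> u \<in> sorts Y \<and> f \<in> car X i \<rightarrow>\<^sub>E car Y u"
      if "i \<in> sorts X" for i
      using on_pred_closed[OF uniform_preorder_car[OF X that] gen[OF that]]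
      by (auto elim: ufam_predsE)
    then obtain u0 f0 where uf0: "\<And>i. i \<in> sorts X \<Longrightarrow>
        on_pred (car X i) (?gen i) = SPred (u0 i) (f0 i) \<and> u0 i \<in> sorts Y \<and>
        f0 i \<in> car X i \<rightarrow>\<^sub>E car Y (u0 i)"
      by metis
    \<comment> \<open>The choice is arbitrary off the sorts, while elements of
      \<open>uord_maps\<close> are extensional.\<close>
    define u where "u = restrict u0 (sorts X)"
    define f where "f = restrict f0 (sorts X)"
    have u: "u i \<in> sorts Y" and f: "f i \<in> car X i \<rightarrow>\<^sub>E car Y (u i)"
      and on_gen: "on_pred (car X i) (?gen i) = SPred (u i) (f i)" if "i \<in> sorts X" for i
      using uf0[OF that] that by (simp_all add: u_def f_def)
    \<comment> \<open>Reindexing the generic predicate along \<open>\<phi>\<close> returns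
      \<open>SPred i \<phi>\<close> exactly, but \<open>F\<close> commutes with this reindexing only
      up to equivalence, hence two inequalities between predicates of possibly different
      sorts.\<close>
    have on: "ufam_le Y M (on_pred M (SPred i \<phi>)) (SPred (u i) (compose M (f i) \<phi>))"
        "ufam_le Y M (SPred (u i) (compose M (f i) \<phi>)) (on_pred M (SPred i \<phi>))"
      if M: "M \<in> U" and i: "i \<in> sorts X" and \<phi>: "\<phi> \<in> M \<rightarrow>\<^sub>E car X i" for M i \<phi>
      using on_pred_re[OF M uniform_preorder_car[OF X i] \<phi> gen[OF i]] i \<phi>
      by (simp_all add: on_gen compose_Id_PiE)
    have "{(f i a, f j b) | a b. (a, b) \<in> r} \<in> rels Y (u i) (u j)"
      if i: "i \<in> sorts X" and j: "j \<in> sorts X" and r: "r \<in> rels X i j" for i j r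
    proof -
      obtain M \<pi> \<rho> where M: "M \<in> U" and \<pi>: "\<pi> \<in> M \<rightarrow>\<^sub>E car X i" and \<rho>: "\<rho> \<in> M \<rightarrow>\<^sub>E car X j"
          and r_eq: "r = {(\<pi> m, \<rho> m) | m. m \<in> M}"
        using relation_span[OF U uniform_preorder_car[OF X i] uniform_preorder_car[OF X j]
            uniform_preorder_rels[OF X i j r]] .
      have P: "SPred i \<pi> \<in> ufam_preds X M" "SPred j \<rho> \<in> ufam_preds X M"
          "SPred (u i) (compose M (f i) \<pi>) \<in> ufam_preds Y M"
          "SPred (u j) (compose M (f j) \<rho>) \<in> ufam_preds Y M"
        using i j \<pi> \<rho> u f by (auto intro: compose_PiE del: PiE_I)
      \<comment> \<open>Over the apex of the span, \<open>r \<in> rels X i j\<close> is an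
        inequality between the two legs. It passes through \<open>F\<close>, and \<open>on\<close>
        then replaces each side by the value of the candidate map.\<close>
      have "ufam_le X M (SPred i \<pi>) (SPred j \<rho>)"
        using r by (simp add: r_eq)
      then have "ufam_le Y M (on_pred M (SPred i \<pi>)) (on_pred M (SPred j \<rho>))"
        using M P by (simp only: on_pred_mono)
      then have "ufam_le Y M (SPred (u i) (compose M (f i) \<pi>)) (on_pred M (SPred j \<rho>))"
        using M P on(2)[OF M i \<pi>] by (blast intro: B.le_trans on_pred_closed)
      then have "ufam_le Y M (SPred (u i) (compose M (f i) \<pi>)) (SPred (u j) (compose M (f j) \<rho>))"
        using M P on(1)[OF M j \<rho>] by (blast intro: B.le_trans on_pred_closed)
      moreover have "{(f i a, f j b) | a b. (a, b) \<in> r} =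
          {(compose M (f i) \<pi> m, compose M (f j) \<rho> m) | m. m \<in> M}"
        by (force simp: r_eq compose_eq)
      ultimately show ?thesis by simp
    qed
    then have uf: "(u, f) \<in> uord_maps X Y"
      using u f by (auto simp: uord_maps_def u_def f_def)
    interpret indexed_monotone_map U "ufam_preds X" "ufam_le X" precomp "ufam_preds Y" "ufam_le Y"
        precomp "ufam_act (u, f)" "\<lambda>M p. snd (ufam_act (u, f) (M, p))"
      using X Y uf by (rule indexed_monotone_map_ufam)
    \<comment> \<open>Comparison with \<open>F\<close> is required at every predicate;
      \<open>on\<close> was proved for all of them, not just the generic ones.\<close>
    have "fiber_le (set_cat U) B.fib (ufam_act (u, f) (M, p)) (fob F (M, p)) \<and>
        fiber_le (set_cat U) B.fib (fob F (M, p)) (ufam_act (u, f) (M, p))"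
      if M: "M \<in> U" and p: "p \<in> ufam_preds X M" for M p
    proof -
      obtain i \<phi> where i: "p = SPred i \<phi>" "i \<in> sorts X" "\<phi> \<in> M \<rightarrow>\<^sub>E car X i"
        using p by (rule ufam_predsE)
      show ?thesis
        using act_closed[OF M p] on_pred_closed[OF M p] on[OF M i(2,3)] M p
        by (simp add: fob_on_pred B.fiber_le_fib i(1) del: SPred_in_ufam_preds)
    qed
    then show ?thesis
      using uf by (intro bexI[of _ "(u, f)"]) (auto simp: PFib_simps ufam_simps A.fib_Obj)
  qed
  then show ?thesis
    using two_functor_ufam
    by (auto simp: local_equivalence_def UOrd_simps(1,2) Le_ufam)
qed

section \<open>The 2-functor \<open>fam\<close>\<close>

lemma two_functor_fam: "two_functor (Ord U) (PFib (set_cat U)) (fam U)"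
proof -
  have preorder: "preorder_on (fst D) (snd D)" if "D \<in> Obj (Ord U)" for D
    using that by (simp add: Ord_simps)
  have ob: "fob (fam U) D \<in> Obj (PFib (set_cat U))" if D: "D \<in> Obj (Ord U)" for D
  proof -
    interpret indexed_preorder U "fam_preds D" "fam_le D" precomp
      using preorder[OF D] by (rule indexed_preorder_fam)
    show ?thesis
      by (simp add: PFib_simps fam_simps posetal_fibration_fib)
  qed
  have id: "farr (fam U) D D (Id (Ord U) D) = id_ftor (total (fob (fam U) D))"
    if D: "D \<in> Obj (Ord U)" for D
  proof -
    interpret indexed_preorder U "fam_preds D" "fam_le D" precomp
      using preorder[OF D] by (rule indexed_preorder_fam)
    show ?thesis
      unfolding fam_simps Ord_simps id_ftor_def
      by (rule mk_ftor_cong) (auto simp: fib_Obj elim!: fam_predsE simp: compose_Id_PiE)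
  qed
  have ar: "farr (fam U) D E f \<in> Hom (PFib (set_cat U)) (fob (fam U) D) (fob (fam U) E)"
    and comp: "farr (fam U) D H (Comp (Ord U) D E H g f) =
      comp_ftor (total (fob (fam U) D)) (farr (fam U) E H g) (farr (fam U) D E f)"
    if D: "D \<in> Obj (Ord U)" and E: "E \<in> Obj (Ord U)" and f: "f \<in> Hom (Ord U) D E" for D E H f g
  proof -
    interpret indexed_monotone_map U "fam_preds D" "fam_le D" precomp "fam_preds E" "fam_le E"
        precomp "fam_act f" "\<lambda>M p. snd (fam_act f (M, p))"
      using preorder[OF D] preorder[OF E] f by (rule indexed_monotone_map_fam)
    show "farr (fam U) D E f \<in> Hom (PFib (set_cat U)) (fob (fam U) D) (fob (fam U) E)"
      using fibered_functor_map by (simp add: PFib_simps fam_simps)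
    show "farr (fam U) D H (Comp (Ord U) D E H g f) =
        comp_ftor (total (fob (fam U) D)) (farr (fam U) E H g) (farr (fam U) D E f)"
      unfolding fam_simps Ord_simps comp_mk_ftor[OF functor_map]
      by (rule mk_ftor_cong) (auto simp: A.fib_Obj elim!: fam_predsE simp: compose_assoc_PiE)
  qed
  have Le: "Le (PFib (set_cat U)) (fob (fam U) D) (fob (fam U) E)
      (farr (fam U) D E f) (farr (fam U) D E g)"
    if D: "D \<in> Obj (Ord U)" and E: "E \<in> Obj (Ord U)" and f: "f \<in> Hom (Ord U) D E"
      and g: "g \<in> Hom (Ord U) D E" and le: "Le (Ord U) D E f g" for D E f g
    unfolding fam_simps
      Le_fob_fib_of_preds[OF indexed_preorder_fam[OF preorder[OF D]]
        indexed_monotone_map_fam[OF preorder[OF D] preorder[OF E] f]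
        indexed_monotone_map_fam[OF preorder[OF D] preorder[OF E] g]]
    using le by (intro ballI, elim fam_predsE) (simp add: Ord_simps compose_eq, blast dest: PiE_mem)
  have "is_functor (Ord U) (PFib (set_cat U)) (fam U)"
    unfolding is_functor_def
    using lpcategory_category[OF lpcategory_PFib] lpcategory_category[OF lpcategory_Ord]
      ob ar id comp
    by (auto simp: PFib_simps(3,4))
  then show ?thesis
    by (auto simp: two_functor_def lpcategory_Ord lpcategory_PFib Le)
qed

section \<open>The comparison of \<open>fam\<close> with \<open>ufam\<close> on one-sorted
  preorders\<close>

fun forget_sort :: "'u set \<times> 'u pred \<Rightarrow> 'u set \<times> 'u pred" where
  "forget_sort (M, SPred i \<phi>) = (M, FPred \<phi>)"
| "forget_sort (M, FPred \<phi>) = (M, FPred \<phi>)"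

text \<open>The sort supplied is \<open>undefined\<close>, the only one that
  \<open>one_sorted\<close> has.\<close>

fun add_sort :: "'u set \<times> 'u pred \<Rightarrow> 'u set \<times> 'u pred" where
  "add_sort (M, FPred \<phi>) = (M, SPred undefined \<phi>)"
| "add_sort (M, SPred i \<phi>) = (M, SPred i \<phi>)"

text \<open>Turns membership in \<open>Pow (snd D)\<close> into the pointwise order, so that
  \<open>ufam_le (one_sorted D)\<close> and \<open>fam_le D\<close> agree after retagging.\<close>

lemma set_pairs_subset: "{(\<phi> m, \<psi> m) | m. m \<in> M} \<subseteq> r \<longleftrightarrow> (\<forall>m\<in>M. (\<phi> m, \<psi> m) \<in> r)"
  by auto

text \<open>Over each set both sides have the same functions as predicates, in the same order, under
  different constructors; the sort is forced to be \<open>undefined\<close>. Hence the two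
  retaggings are strictly inverse.\<close>

lemma iso_arrow_forget_sort:
  assumes U: "set_universe U" and D: "D \<in> Obj (Ord U)"
  shows "iso_arrow (PFib (set_cat U)) (fob (ufam U) (one_sorted D)) (fob (fam U) D)
    (mk_ftor (total (fob (ufam U) (one_sorted D))) forget_sort (\<lambda>p q g. g))"
proof -
  have "uniform_preorder U (one_sorted D)" and preorder: "preorder_on (fst D) (snd D)"
    using D by (simp_all add: Ord_simps uniform_preorder_one_sorted U)
  then interpret A: indexed_preorder U "ufam_preds (one_sorted D)" "ufam_le (one_sorted D)" precomp
    by (simp add: indexed_preorder_ufam)
  interpret B: indexed_preorder U "fam_preds D" "fam_le D" precomp
    using preorder by (rule indexed_preorder_fam)
  interpret F: indexed_monotone_map U "ufam_preds (one_sorted D)" "ufam_le (one_sorted D)" precomp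
      "fam_preds D" "fam_le D" precomp forget_sort "\<lambda>M p. snd (forget_sort (M, p))"
    by unfold_locales (auto elim!: ufam_predsE simp: set_pairs_subset del: PiE_I PiE_E)
  interpret G: indexed_monotone_map U "fam_preds D" "fam_le D" precomp "ufam_preds (one_sorted D)"
      "ufam_le (one_sorted D)" precomp add_sort "\<lambda>M p. snd (add_sort (M, p))"
    by unfold_locales (auto elim!: fam_predsE simp: set_pairs_subset del: PiE_I PiE_E)
  have "comp_ftor (total A.fib) G.map_ftor F.map_ftor = id_ftor (total A.fib)"
    unfolding comp_mk_ftor[OF F.functor_map] id_ftor_def
    by (rule mk_ftor_cong) (auto simp: A.fib_Obj elim!: ufam_predsE)
  moreover have "comp_ftor (total B.fib) F.map_ftor G.map_ftor = id_ftor (total B.fib)"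
    unfolding comp_mk_ftor[OF G.functor_map] id_ftor_def
    by (rule mk_ftor_cong) (auto simp: B.fib_Obj elim!: fam_predsE)
  ultimately show ?thesis
    unfolding iso_arrow_def PFib_simps ufam_simps fam_simps
    using F.fibered_functor_map G.fibered_functor_map
    by (intro conjI bexI[of _ G.map_ftor]) (simp_all add: PFib_simps)
qed

text \<open>Retagging leaves the function alone, and both composites postcompose it with
  \<open>f\<close>. Most of the proof supplies the functor hypotheses under which
  \<open>comp_mk_ftor\<close> merges each composite.\<close>

lemma forget_sort_natural:
  assumes U: "set_universe U" and D: "D \<in> Obj (Ord U)" and E: "E \<in> Obj (Ord U)"
    and f: "f \<in> Hom (Ord U) D E"
  shows "comp_ftor (total (fob (ufam U) (one_sorted D)))
      (mk_ftor (total (fob (ufam U) (one_sorted E))) forget_sort (\<lambda>p q g. g))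
      (farr (ufam U) (one_sorted D) (one_sorted E) (farr ord_to_uord D E f)) =
    comp_ftor (total (fob (ufam U) (one_sorted D))) (farr (fam U) D E f)
      (mk_ftor (total (fob (ufam U) (one_sorted D))) forget_sort (\<lambda>p q g. g))"
proof -
  note ord = local_equivalence_two_functor[OF local_equivalence_ord_to_uord[OF U],
      THEN two_functor_functor]
  have fob: "fob ord_to_uord D = one_sorted D" for D :: "'a set \<times> ('a \<times> 'a) set"
    by (simp add: ord_to_uord_def)
  note uf = functor_fob[OF two_functor_functor[OF two_functor_ufam]]
    functor_farr[OF two_functor_functor[OF two_functor_ufam]]
  have X: "one_sorted D \<in> Obj (UOrd U)" "one_sorted E \<in> Obj (UOrd U)"
    using functor_fob[OF ord D] functor_fob[OF ord E] by (simp_all add: fob)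
  have h: "farr ord_to_uord D E f \<in> Hom (UOrd U) (one_sorted D) (one_sorted E)"
    using functor_farr[OF ord D E f] by (simp add: fob)
  interpret indexed_preorder U "ufam_preds (one_sorted D)" "ufam_le (one_sorted D)" precomp
    using X by (simp add: indexed_preorder_ufam UOrd_simps)
  have "is_functor (total (fob (ufam U) (one_sorted D))) (total (fob (ufam U) (one_sorted E)))
      (farr (ufam U) (one_sorted D) (one_sorted E) (farr ord_to_uord D E f))"
    using uf(2)[OF X h] by (simp add: PFib_simps fibered_functor_def)
  note act = this[unfolded ufam_simps]
  have "is_functor (total (fob (ufam U) (one_sorted D))) (total (fob (fam U) D))
      (mk_ftor (total (fob (ufam U) (one_sorted D))) forget_sort (\<lambda>p q g. g))"
    using iso_arrow_forget_sort[OF U D]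
    by (simp add: iso_arrow_def PFib_simps fibered_functor_def)
  note forget = this[unfolded ufam_simps fam_simps]
  show ?thesis
    unfolding ufam_simps fam_simps comp_mk_ftor[OF act] comp_mk_ftor[OF forget]
    by (rule mk_ftor_cong) (auto simp: fib_Obj ord_to_uord_def elim!: ufam_predsE)
qed

lemma ufam_one_sorted_isomorphic_fam:
  assumes U: "set_universe U"
  shows "two_functors_isomorphic (Ord U) (PFib (set_cat U))
    (comp_ftor (Ord U) (ufam U) ord_to_uord) (fam U)"
proof -
  have "two_functor (Ord U) (PFib (set_cat U)) (comp_ftor (Ord U) (ufam U) ord_to_uord)"
    using local_equivalence_two_functor[OF local_equivalence_ord_to_uord[OF U]] two_functor_ufam
    by (rule two_functor_comp)
  moreover have fob: "fob ord_to_uord D = one_sorted D" for D :: "'a set \<times> ('a \<times> 'a) set"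
    by (simp add: ord_to_uord_def)
  ultimately show ?thesis
    unfolding two_functors_isomorphic_def
    using two_functor_fam
    by (intro conjI exI[of _ "\<lambda>D. mk_ftor (total (fob (ufam U) (one_sorted D))) forget_sort
        (\<lambda>p q g. g)"])
      (simp_all add: comp_ftor_def[of "Ord U"] iso_arrow_forget_sort[OF U] PFib_simps(4)
        forget_sort_natural[OF U])
qed

theorem lemma4p2p2:
  fixes U :: "'u set set"
  assumes "set_universe U"
  shows "local_equivalence (UOrd U) (PFib (set_cat U)) (ufam U)
    \<and> local_equivalence (Ord U) (UOrd U) ord_to_uord
    \<and> local_equivalence (Ord U) (PFib (set_cat U)) (fam U)
    \<and> two_functors_isomorphic (Ord U) (PFib (set_cat U))
        (comp_ftor (Ord U) (ufam U) ord_to_uord) (fam U)"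
  using local_equivalence_ufam[OF assms] local_equivalence_ord_to_uord[OF assms]
    ufam_one_sorted_isomorphic_fam[OF assms]
  by (blast intro: local_equivalence_isomorphic local_equivalence_comp)

end
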